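(* The coordination capacity region $\mathcal{C}_{p_0}$ for empirical coordination in the broadcast network with source distribution $p_0(x)$ satisfies $$\mathcal{C}_{p_0,in}\subset\mathcal{C}_{p_0}\subset\mathcal{C}_{p_0,out},$$ where $\mathcal{C}_{p_0,in}$ is the set of tuples $(R_1,R_2,p(y,z|x))$ for which there exists a conditional distribution $p(u|x,y,z)$ of an auxiliary random variable $U$ such that $$R_1\ge I(X;U,Y),\quad R_2\ge I(X;U,Z),\quad R_1+R_2\ge I(X;U,Y)+I(X;U,Z)+I(Y;Z|X,U),$$ and $\mathcal{C}_{p_0,out}$ is the set of tuples $(R_1,R_2,p(y,z|x))$ such that $$R_1\ge I(X;Y),\quad R_2\ge I(X;Z),\quad R_1+R_2\ge I(X;Y,Z).$$ Information quantities are computed under $p_0(x)p(y,z|x)p(u|x,y,z)$ (respectively $p_0(x)p(y,z|x)$).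
   Context: Alphabets (including that of the auxiliary variable $U$) are finite; rates are nonnegative reals measured in bits (logarithms base 2); $\{1,\dots,2^{nR}\}$ denotes the set of integers $k$ with $1\le k\le 2^{nR}$; $\subset$ allows equality. Broadcast network: a $(2^{nR_1},2^{nR_2},n)$ coordination code consists of two encoding functions $i:\mathcal{X}^n\to\{1,\dots,2^{nR_1}\}$, $j:\mathcal{X}^n\to\{1,\dots,2^{nR_2}\}$ and two decoding functions $y^n:\{1,\dots,2^{nR_1}\}\to\mathcal{Y}^n$, $z^n:\{1,\dots,2^{nR_2}\}\to\mathcal{Z}^n$. The actions $X^n$ are i.i.d. according to $p_0(x)$, $Y^n=y^n(i(X^n))$, and $Z^n=z^n(j(X^n))$. The joint type is $P_{x^n,y^n,z^n}(x,y,z)=\frac1n\sum_{i=1}^n\mathbf{1}((x_i,y_i,z_i)=(x,y,z))$. Total variation is $\|p-q\|_{TV}=\frac12\sum|p-q|$. The distribution $p_0(x)p(y,z|x)$ is achievable for empirical coordination at rates $(R_1,R_2)$ if there exists a sequence of $(2^{nR_1},2^{nR_2},n)$ coordination codes ($n=1,2,\dots$) such that $\|P_{X^n,Y^n,Z^n}-p_0(x)p(y,z|x)\|_{TV}\to0$ in probability. The coordination capacity region $\mathcal{C}_{p_0}$ is the closure of the set of tuples $(R_1,R_2,p(y,z|x))$ such that $p_0(x)p(y,z|x)$ is achievable at rates $(R_1,R_2)$. *)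

theory Defs
  imports "HOL-Probability.Probability"
begin

text \<open>
  Finite alphabets are types of class \<open>finite\<close>; sequences of length \<open>n\<close> are lists of length \<open>n\<close>.
  A conditional distribution \<open>p(y,z|x)\<close> is a kernel \<open>K :: 'x \<Rightarrow> ('y \<times> 'z) pmf\<close>.
\<close>

definition message_set :: "real \<Rightarrow> nat \<Rightarrow> nat set" where
  "message_set R n = {k. 1 \<le> k \<and> real k \<le> 2 powr (real n * R)}"

definition joint_type :: "'x list \<Rightarrow> 'y list \<Rightarrow> 'z list \<Rightarrow> 'x \<times> 'y \<times> 'z \<Rightarrow> real" where
  "joint_type xs ys zs t =
     1 / real (length xs) * (\<Sum>k<length xs. of_bool ((xs ! k, ys ! k, zs ! k) = t))"

definition tv_dist :: "('a::finite \<Rightarrow> real) \<Rightarrow> ('a \<Rightarrow> real) \<Rightarrow> real" where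
  "tv_dist p q = 1 / 2 * (\<Sum>a\<in>UNIV. \<bar>p a - q a\<bar>)"

definition joint_pmf :: "'x pmf \<Rightarrow> ('x \<Rightarrow> ('y \<times> 'z) pmf) \<Rightarrow> ('x \<times> 'y \<times> 'z) pmf" where
  "joint_pmf p0 K = do {x \<leftarrow> p0; (y, z) \<leftarrow> K x; return_pmf (x, y, z)}"

definition joint_aux_pmf ::
  "'x pmf \<Rightarrow> ('x \<Rightarrow> ('y \<times> 'z) pmf) \<Rightarrow> ('x \<Rightarrow> 'y \<Rightarrow> 'z \<Rightarrow> 'u pmf) \<Rightarrow> ('x \<times> 'y \<times> 'z \<times> 'u) pmf" where
  "joint_aux_pmf p0 K W =
     do {(x, y, z) \<leftarrow> joint_pmf p0 K; u \<leftarrow> W x y z; return_pmf (x, y, z, u)}"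

definition coordination_code ::
  "real \<Rightarrow> real \<Rightarrow> nat \<Rightarrow> ('x list \<Rightarrow> nat) \<Rightarrow> ('x list \<Rightarrow> nat) \<Rightarrow>
   (nat \<Rightarrow> 'y list) \<Rightarrow> (nat \<Rightarrow> 'z list) \<Rightarrow> bool" where
  "coordination_code R1 R2 n i j yd zd \<longleftrightarrow>
     (\<forall>xs. length xs = n \<longrightarrow> i xs \<in> message_set R1 n \<and> j xs \<in> message_set R2 n) \<and>
     (\<forall>k\<in>message_set R1 n. length (yd k) = n) \<and>
     (\<forall>k\<in>message_set R2 n. length (zd k) = n)"

definition achievable ::
  "'x::finite pmf \<Rightarrow> ('x \<Rightarrow> ('y::finite \<times> 'z::finite) pmf) \<Rightarrow> real \<Rightarrow> real \<Rightarrow> bool" where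
  "achievable p0 K R1 R2 \<longleftrightarrow>
     (\<exists>i j yd zd.
        (\<forall>n\<ge>1. coordination_code R1 R2 n (i n) (j n) (yd n) (zd n)) \<and>
        (\<forall>\<epsilon>>0. (\<lambda>n. measure_pmf.prob (replicate_pmf n p0)
            {xs. tv_dist (joint_type xs (yd n (i n xs)) (zd n (j n xs))) (pmf (joint_pmf p0 K)) > \<epsilon>})
          \<longlonglongrightarrow> 0))"

text \<open>
  To take closures, the kernel is replaced by its table of probabilities, a point of the space
  \<open>'x \<Rightarrow> 'y \<times> 'z \<Rightarrow> real\<close> with the product topology. For finite alphabets this is the Euclidean
  topology, and the tables of kernels form a closed set.
\<close>

type_synonym ('x, 'y, 'z) rate_tuple = "real \<times> real \<times> ('x \<Rightarrow> 'y \<times> 'z \<Rightarrow> real)"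

definition rate_tuple ::
  "real \<Rightarrow> real \<Rightarrow> ('x \<Rightarrow> ('y \<times> 'z) pmf) \<Rightarrow> ('x, 'y, 'z) rate_tuple" where
  "rate_tuple R1 R2 K = (R1, R2, \<lambda>x. pmf (K x))"

definition capacity_region ::
  "'x::finite pmf \<Rightarrow> ('x, 'y::finite, 'z::finite) rate_tuple set" where
  "capacity_region p0 =
     closure {rate_tuple R1 R2 K | R1 R2 K. R1 \<ge> 0 \<and> R2 \<ge> 0 \<and> achievable p0 K R1 R2}"

definition mutual_info :: "'o pmf \<Rightarrow> ('o \<Rightarrow> 'a) \<Rightarrow> ('o \<Rightarrow> 'b) \<Rightarrow> real" where
  "mutual_info q A B =
     prob_space.mutual_information (measure_pmf q) 2 (count_space UNIV) (count_space UNIV) A B"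

definition cond_mutual_info ::
  "'o pmf \<Rightarrow> ('o \<Rightarrow> 'a) \<Rightarrow> ('o \<Rightarrow> 'b) \<Rightarrow> ('o \<Rightarrow> 'c) \<Rightarrow> real" where
  "cond_mutual_info q A B C =
     prob_space.conditional_mutual_information (measure_pmf q) 2
       (count_space UNIV) (count_space UNIV) (count_space UNIV) A B C"

text \<open>
  The auxiliary variable ranges over an arbitrary finite alphabet, which may be taken to be
  \<open>{..<m}\<close> for some \<open>m\<close>.
\<close>

definition inner_region ::
  "'x::finite pmf \<Rightarrow> ('x, 'y::finite, 'z::finite) rate_tuple set" where
  "inner_region p0 =
     {rate_tuple R1 R2 K | R1 R2 K. R1 \<ge> 0 \<and> R2 \<ge> 0 \<and>
        (\<exists>(m::nat) (W :: 'x \<Rightarrow> 'y \<Rightarrow> 'z \<Rightarrow> nat pmf).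
           (\<forall>x y z. set_pmf (W x y z) \<subseteq> {..<m}) \<and>
           (let q = joint_aux_pmf p0 K W;
                X = (\<lambda>(x, y, z, u). x); Y = (\<lambda>(x, y, z, u). y);
                Z = (\<lambda>(x, y, z, u). z); U = (\<lambda>(x, y, z, u). u);
                UY = (\<lambda>w. (U w, Y w)); UZ = (\<lambda>w. (U w, Z w)); XU = (\<lambda>w. (X w, U w))
            in R1 \<ge> mutual_info q X UY \<and>
               R2 \<ge> mutual_info q X UZ \<and>
               R1 + R2 \<ge> mutual_info q X UY + mutual_info q X UZ + cond_mutual_info q Y Z XU))}"

definition outer_region ::
  "'x::finite pmf \<Rightarrow> ('x, 'y::finite, 'z::finite) rate_tuple set" where
  "outer_region p0 =
     {rate_tuple R1 R2 K | R1 R2 K. R1 \<ge> 0 \<and> R2 \<ge> 0 \<and>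
        (let q = joint_pmf p0 K;
             X = (\<lambda>(x, y, z). x); Y = (\<lambda>(x, y, z). y); Z = (\<lambda>(x, y, z). z);
             YZ = (\<lambda>w. (Y w, Z w))
         in R1 \<ge> mutual_info q X Y \<and>
            R2 \<ge> mutual_info q X Z \<and>
            R1 + R2 \<ge> mutual_info q X YZ)}"

end

theory Submission
  imports Defs
begin

text \<open>
  Inner bound: a random codebook consists of independent clusters, each holding one word \<open>u\<close> and
  independent words \<open>y\<close> and \<open>z\<close> drawn given \<open>u\<close>. Weighting the triples of a cluster by the likelihood
  ratio of \<open>p(u, y, z | x)\<close> to \<open>p(u) p(y | u) p(z | u)\<close>, restricted to typical sequences, a second moment
  computation bounds from below the probability that a cluster contains a triple typical with a given
  \<open>x\<close>. Typicality only asks that the joint type and the information densities be close to their means,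
  so that the weak law of large numbers suffices and no types have to be counted.

  Outer bound: for the mean joint type \<open>r\<close> of a code, the logarithm of the likelihood ratio of
  \<open>r(x | y)\<close> to \<open>p(x)\<close> along the block has mean \<open>n * I(X; Y)\<close>. By Jensen's inequality this is at most the
  logarithm of the mean of the ratio itself, which is at most the number of messages. The mean
  joint type tends to the target distribution, and mutual information is continuous in the table of
  probabilities, which also shows that the outer region is closed.
\<close>

section \<open>Expectations under i.i.d. sequences\<close>

text \<open>Both encoders see all of \<open>x\<close>, so they can agree on one triple of indices
  \<open>(k, a, b)\<close> without communicating; the first message carries \<open>(k, a)\<close>,
  the second \<open>(k, b)\<close>. The cluster index is paid for twice, and the sum-rate condition
  of the inner region is accordingly read as I(X;U) plus I(X;U,Y,Z) + I(Y;Z|U). The obstacle is that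
  the pairs of words in a cluster reuse their components and so are not independent trials; only
  different clusters are independent. Hence a second moment bound inside a cluster and a product
  bound across clusters. Restricting to typical sequences caps the likelihood ratios, and upper
  bounds on them suffice. Codes are found for each tolerance separately and with positive rate
  slack: a diagonal choice yields one sequence of codes, and the closure in the capacity region
  absorbs the slack. For the outer bound, the sum rate is the one-decoder bound applied to the pair
  of messages. Because of the closure, information is expressed by a formula that is continuous on
  all real tables, not only on those of distributions.\<close>

lemma expectation_finite:
  fixes f :: "'a \<Rightarrow> real"
  assumes "finite (set_pmf p)"
  shows "measure_pmf.expectation p f = (\<Sum>a\<in>set_pmf p. pmf p a * f a)"
  using assms by (subst integral_measure_pmf[of "set_pmf p"]) auto

lemma expectation_bind:
  fixes h :: "'b \<Rightarrow> real"
  assumes "finite (set_pmf p)" "\<And>x. x \<in> set_pmf p \<Longrightarrow> finite (set_pmf (f x))"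
  shows "measure_pmf.expectation (p \<bind> f) h =
    measure_pmf.expectation p (\<lambda>a. measure_pmf.expectation (f a) h)"
  using assms by (subst pmf_expectation_bind[of "set_pmf p"]) (auto simp: expectation_finite)

lemma expectation_swap:
  fixes f :: "'a \<Rightarrow> 'b \<Rightarrow> real"
  assumes "finite (set_pmf p)" "finite (set_pmf q)"
  shows "measure_pmf.expectation p (\<lambda>x. measure_pmf.expectation q (f x)) =
    measure_pmf.expectation q (\<lambda>y. measure_pmf.expectation p (\<lambda>x. f x y))"
  using assms
  by (simp add: expectation_finite sum_distrib_left sum.swap[of _ "set_pmf p"] mult.left_commute)

lemma expectation_sum_list:
  fixes f :: "'a \<Rightarrow> 'b \<Rightarrow> real"
  assumes "finite (set_pmf p)"
  shows "measure_pmf.expectation p (\<lambda>x. \<Sum>y\<leftarrow>ys. f x y) = (\<Sum>y\<leftarrow>ys. measure_pmf.expectation p (\<lambda>x. f x y))"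
  using assms by (induction ys) (simp_all add: integrable_measure_pmf_finite)

lemma expectation_mono_finite:
  fixes f g :: "'a \<Rightarrow> real"
  assumes "finite (set_pmf p)" "\<And>x. x \<in> set_pmf p \<Longrightarrow> f x \<le> g x"
  shows "measure_pmf.expectation p f \<le> measure_pmf.expectation p g"
  using assms by (simp add: expectation_finite sum_mono mult_left_mono)

lemma expectation_cong_finite:
  fixes f g :: "'a \<Rightarrow> real"
  assumes "\<And>x. x \<in> set_pmf p \<Longrightarrow> f x = g x"
  shows "measure_pmf.expectation p f = measure_pmf.expectation p g"
  using assms by (intro integral_cong_AE) (auto simp: AE_measure_pmf_iff)

lemma prob_eq_expectation:
  "measure_pmf.prob p A = measure_pmf.expectation p (\<lambda>x. of_bool (x \<in> A))"
proof -
  have "measure_pmf.prob p A = measure_pmf.expectation p (indicator A)" by simp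
  also have "(indicator A :: 'a \<Rightarrow> real) = (\<lambda>x. of_bool (x \<in> A))" by (auto simp: indicator_def)
  finally show ?thesis .
qed

text \<open>Passes from an average over random codebooks to one fixed codebook.\<close>

lemma exists_le_expectation:
  fixes f :: "'a \<Rightarrow> real"
  assumes "finite (set_pmf p)"
  shows "\<exists>x\<in>set_pmf p. f x \<le> measure_pmf.expectation p f"
proof (rule ccontr)
  assume "\<not> ?thesis"
  then have *: "measure_pmf.expectation p f < f x" if "x \<in> set_pmf p" for x using that by auto
  have "(\<Sum>a\<in>set_pmf p. pmf p a * measure_pmf.expectation p f) < (\<Sum>a\<in>set_pmf p. pmf p a * f a)"
    using assms * by (intro sum_strict_mono) (auto simp: set_pmf_not_empty pmf_positive)
  then show False
    using assms by (simp add: expectation_finite sum_distrib_right[symmetric] sum_pmf_eq_1)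
qed

lemma finite_set_replicate_pmf [simp]:
  "finite (set_pmf p) \<Longrightarrow> finite (set_pmf (replicate_pmf n p))"
  using finite_lists_length_eq[of "set_pmf p" n]
  by (simp add: set_replicate_pmf lists_eq_set Collect_conj_eq conj_commute)

lemma expectation_replicate_Suc:
  fixes h :: "'a list \<Rightarrow> real"
  assumes "finite (set_pmf p)"
  shows "measure_pmf.expectation (replicate_pmf (Suc n) p) h =
    measure_pmf.expectation p (\<lambda>x. measure_pmf.expectation (replicate_pmf n p) (\<lambda>xs. h (x # xs)))"
  using assms by (simp add: expectation_bind)

lemma expectation_sum_replicate:
  fixes h :: "'a \<Rightarrow> real"
  assumes "finite (set_pmf p)"
  shows "measure_pmf.expectation (replicate_pmf n p) (\<lambda>xs. \<Sum>x\<leftarrow>xs. h x) = n * measure_pmf.expectation p h"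
proof (induction n)
  case (Suc n)
  then show ?case using assms
    by (simp add: expectation_replicate_Suc integrable_measure_pmf_finite algebra_simps
             del: replicate_pmf.simps)
qed simp

text \<open>Distinct positions are independent, so each of the n(n - 1) off-diagonal terms
  contributes the squared mean. The subtraction is real, which is harmless at n = 0. The formula
  serves both the weak law and the second moment of a cluster.\<close>

lemma expectation_sum_replicate_square:
  fixes h :: "'a \<Rightarrow> real"
  assumes "finite (set_pmf p)"
  shows "measure_pmf.expectation (replicate_pmf n p) (\<lambda>xs. (\<Sum>x\<leftarrow>xs. h x)\<^sup>2) =
    n * measure_pmf.expectation p (\<lambda>x. (h x)\<^sup>2) + real n * (real n - 1) * (measure_pmf.expectation p h)\<^sup>2"
proof (induction n)
  case (Suc n)
  have "measure_pmf.expectation (replicate_pmf (Suc n) p) (\<lambda>xs. (\<Sum>x\<leftarrow>xs. h x)\<^sup>2) =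
     measure_pmf.expectation p (\<lambda>x. measure_pmf.expectation (replicate_pmf n p)
        (\<lambda>xs. (h x)\<^sup>2 + 2 * h x * (\<Sum>x\<leftarrow>xs. h x) + (\<Sum>x\<leftarrow>xs. h x)\<^sup>2))"
    using assms by (simp add: expectation_replicate_Suc power2_eq_square algebra_simps del: replicate_pmf.simps)
  also have "\<dots> = measure_pmf.expectation p (\<lambda>x. (h x)\<^sup>2 + 2 * h x * (n * measure_pmf.expectation p h)
      + measure_pmf.expectation (replicate_pmf n p) (\<lambda>xs. (\<Sum>x\<leftarrow>xs. h x)\<^sup>2))"
    using assms by (simp add: expectation_sum_replicate integrable_measure_pmf_finite)
  also have "\<dots> = measure_pmf.expectation p (\<lambda>x. (h x)\<^sup>2) + 2 * n * (measure_pmf.expectation p h)\<^sup>2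
      + measure_pmf.expectation (replicate_pmf n p) (\<lambda>xs. (\<Sum>x\<leftarrow>xs. h x)\<^sup>2)"
    using assms by (simp add: integrable_measure_pmf_finite power2_eq_square)
  finally show ?case using Suc by (simp add: algebra_simps power2_eq_square)
qed simp

text \<open>Chebyshev's inequality: after centering, the off-diagonal terms of the second moment
  vanish and n times the variance remains, which gives the bound
  \<open>V / \<delta>\<^sup>2 / n\<close>.\<close>

lemma weak_law_replicate_pmf:
  fixes h :: "'a \<Rightarrow> real" and \<delta> :: real
  assumes fin: "finite (set_pmf p)" and "\<delta> > 0"
  shows "(\<lambda>n. measure_pmf.prob (replicate_pmf n p)
    {xs. \<bar>(\<Sum>x\<leftarrow>xs. h x) - n * measure_pmf.expectation p h\<bar> \<ge> n * \<delta>}) \<longlonglongrightarrow> 0"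
proof -
  define m where "m = measure_pmf.expectation p h"
  define V where "V = measure_pmf.expectation p (\<lambda>x. (h x - m)\<^sup>2)"
  have bound: "measure_pmf.prob (replicate_pmf n p)
      {xs. \<bar>(\<Sum>x\<leftarrow>xs. h x) - n * m\<bar> \<ge> n * \<delta>} \<le> (V / \<delta>\<^sup>2) / n" if "n > 0" for n
  proof -
    let ?R = "replicate_pmf n p"
    have centered: "(\<Sum>x\<leftarrow>xs. h x - m) = (\<Sum>x\<leftarrow>xs. h x) - n * m" if "xs \<in> set_pmf ?R" for xs
      using that by (simp add: set_replicate_pmf sum_list_subtractf sum_list_triv)
    have "measure_pmf.prob ?R {xs. \<bar>(\<Sum>x\<leftarrow>xs. h x) - n * m\<bar> \<ge> n * \<delta>} =
       measure_pmf.prob ?R {xs \<in> space (measure_pmf ?R). \<bar>\<Sum>x\<leftarrow>xs. h x - m\<bar> \<ge> n * \<delta>}"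
      using centered by (intro measure_pmf.finite_measure_eq_AE) (auto simp: AE_measure_pmf_iff)
    also have "\<dots> \<le> measure_pmf.expectation ?R (\<lambda>xs. (\<Sum>x\<leftarrow>xs. h x - m)\<^sup>2) / (n * \<delta>)\<^sup>2"
      using assms that
      by (intro measure_pmf.second_moment_method) (auto intro: integrable_measure_pmf_finite)
    also have "measure_pmf.expectation ?R (\<lambda>xs. (\<Sum>x\<leftarrow>xs. h x - m)\<^sup>2) = n * V"
      using fin by (simp add: expectation_sum_replicate_square V_def integrable_measure_pmf_finite m_def)
    also have "n * V / (n * \<delta>)\<^sup>2 = (V / \<delta>\<^sup>2) / n"
      using that assms by (simp add: power2_eq_square field_simps)
    finally show ?thesis .
  qed
  show ?thesis
    unfolding m_def[symmetric]
  proof (rule tendsto_sandwich[OF _ _ tendsto_const lim_const_over_n[of "V / \<delta>\<^sup>2"]])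
    show "eventually (\<lambda>n. measure_pmf.prob (replicate_pmf n p)
      {xs. \<bar>(\<Sum>x\<leftarrow>xs. h x) - n * m\<bar> \<ge> n * \<delta>} \<le> (V / \<delta>\<^sup>2) / n) sequentially"
      using bound by (intro eventually_sequentiallyI[of 1]) auto
  qed auto
qed

lemma map_replicate_pmf: "map_pmf (map f) (replicate_pmf n p) = replicate_pmf n (map_pmf f p)"
proof (induction n)
  case (Suc n)
  show ?case by (simp add: map_bind_pmf bind_map_pmf Suc[symmetric] pmf.map_comp o_def flip: map_pmf_def)
qed simp

lemma pmf_replicate_pmf:
  "length xs = n \<Longrightarrow> pmf (replicate_pmf n p) xs = prod_list (map (pmf p) xs)"
proof (induction n arbitrary: xs)
  case (Suc n)
  then obtain y ys where xs: "xs = y # ys" "length ys = n" by (auto simp: length_Suc_conv)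
  have "replicate_pmf (Suc n) p = map_pmf (\<lambda>(x, xs). x # xs) (pair_pmf p (replicate_pmf n p))"
    by (simp add: pair_pmf_def map_bind_pmf)
  also have "pmf \<dots> (y # ys) = pmf (pair_pmf p (replicate_pmf n p)) (y, ys)"
    by (subst pmf_map_inj'[of "\<lambda>(x, xs). x # xs", symmetric]) (auto simp: inj_def)
  finally show ?case using Suc xs by (simp add: pmf_pair)
qed simp

lemma prob_replicate_forall:
  assumes "finite (set_pmf p)"
  shows "measure_pmf.prob (replicate_pmf n p) {xs. \<forall>x\<in>set xs. P x} = measure_pmf.prob p {x. P x} ^ n"
proof (induction n)
  case (Suc n)
  have "measure_pmf.prob (replicate_pmf (Suc n) p) {xs. \<forall>x\<in>set xs. P x} =
     measure_pmf.expectation p (\<lambda>x. of_bool (P x) * measure_pmf.prob (replicate_pmf n p) {xs. \<forall>x\<in>set xs. P x})"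
    using assms by (simp add: prob_eq_expectation expectation_replicate_Suc of_bool_conj
      del: replicate_pmf.simps)
  also have "\<dots> = measure_pmf.prob p {x. P x} * measure_pmf.prob (replicate_pmf n p) {xs. \<forall>x\<in>set xs. P x}"
    by (simp add: prob_eq_expectation)
  finally show ?case using Suc by simp
qed simp

section \<open>Information quantities of finitely supported distributions\<close>

text \<open>Probability of the value of \<open>F\<close> observed at \<open>w\<close>; its negative
  logarithm is the self-information. It depends on \<open>F\<close> only through the partition of
  outcomes, so tuples may be permuted and regrouped freely.\<close>

definition atom_prob :: "'o pmf \<Rightarrow> ('o \<Rightarrow> 'a) \<Rightarrow> 'o \<Rightarrow> real" where
  "atom_prob q F w = measure_pmf.prob q {v. F v = F w}"

definition pmf_entropy :: "'o pmf \<Rightarrow> ('o \<Rightarrow> 'a) \<Rightarrow> real" where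
  "pmf_entropy q F = - measure_pmf.expectation q (\<lambda>w. log 2 (atom_prob q F w))"

lemma atom_prob_eq_pmf: "atom_prob q F w = pmf (map_pmf F q) (F w)"
  by (simp add: atom_prob_def pmf_map vimage_def)

lemma atom_prob_pos: "w \<in> set_pmf q \<Longrightarrow> atom_prob q F w > 0"
  unfolding atom_prob_def by (rule measure_pmf_posI) auto

lemma atom_prob_cong: "(\<And>v w. F v = F w \<longleftrightarrow> G v = G w) \<Longrightarrow> atom_prob q F = atom_prob q G"
  by (auto simp: atom_prob_def)

lemma pmf_entropy_cong: "(\<And>v w. F v = F w \<longleftrightarrow> G v = G w) \<Longrightarrow> pmf_entropy q F = pmf_entropy q G"
  unfolding pmf_entropy_def by (subst atom_prob_cong[of F G]) auto

lemma distributed_pmf: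
  "distributed (measure_pmf q) (count_space UNIV) F (\<lambda>x. ennreal (pmf (map_pmf F q) x))"
  unfolding distributed_def
  by (simp add: map_pmf_rep_eq[symmetric] measure_pmf_eq_density[symmetric])

text \<open>Countable value types make the product of the counting spaces discrete, so the point
  masses are densities and the library's formula becomes the mean of a log ratio. Finite support
  makes the three logarithms separately integrable.\<close>

lemma mutual_info_eq_entropy:
  fixes A :: "'o \<Rightarrow> 'a::countable" and B :: "'o \<Rightarrow> 'b::countable"
  assumes fin: "finite (set_pmf q)"
  shows "mutual_info q A B = pmf_entropy q A + pmf_entropy q B - pmf_entropy q (\<lambda>w. (A w, B w))"
proof -
  interpret information_space "measure_pmf q" 2 by standard simp
  let ?C = "\<lambda>w. (A w, B w)"
  define f where "f x = pmf (map_pmf ?C q) x *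
    log 2 (pmf (map_pmf ?C q) x / (pmf (map_pmf A q) (fst x) * pmf (map_pmf B q) (snd x)))" for x
  have pair: "count_space (UNIV :: 'a set) \<Otimes>\<^sub>M count_space (UNIV :: 'b set) = count_space UNIV"
    by (simp add: pair_measure_countable)
  have "mutual_info q A B = integral\<^sup>L (count_space UNIV \<Otimes>\<^sub>M count_space UNIV) f"
    unfolding mutual_info_def f_def
  proof (rule mutual_information_distr)
    show "distributed (measure_pmf q) (count_space UNIV \<Otimes>\<^sub>M count_space UNIV) ?C
      (\<lambda>x. ennreal (pmf (map_pmf ?C q) x))"
      unfolding pair by (rule distributed_pmf)
  qed (auto intro: distributed_pmf sigma_finite_measure_count_space)
  also have "\<dots> = measure_pmf.expectation (map_pmf ?C q)
     (\<lambda>x. log 2 (pmf (map_pmf ?C q) x / (pmf (map_pmf A q) (fst x) * pmf (map_pmf B q) (snd x))))"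
    unfolding pair f_def by (subst measure_pmf_eq_density) (simp add: integral_density)
  also have "\<dots> = measure_pmf.expectation q
     (\<lambda>w. log 2 (atom_prob q ?C w / (atom_prob q A w * atom_prob q B w)))"
    by (simp add: atom_prob_eq_pmf)
  also have "\<dots> = measure_pmf.expectation q
     (\<lambda>w. log 2 (atom_prob q ?C w) - log 2 (atom_prob q A w) - log 2 (atom_prob q B w))"
    by (intro expectation_cong_finite)
       (simp add: log_divide log_mult atom_prob_pos less_imp_neq[OF atom_prob_pos, symmetric])
  finally show ?thesis
    using fin by (simp add: pmf_entropy_def integrable_measure_pmf_finite)
qed

text \<open>The library defines the conditional quantity by the chain rule, as a difference of two
  mutual informations with first argument \<open>A\<close>; the entropy of \<open>A\<close>
  cancels.\<close>

lemma cond_mutual_info_eq_entropy: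
  fixes A :: "'o \<Rightarrow> 'a::countable" and B :: "'o \<Rightarrow> 'b::countable" and C :: "'o \<Rightarrow> 'c::countable"
  assumes fin: "finite (set_pmf q)"
  shows "cond_mutual_info q A B C = pmf_entropy q (\<lambda>w. (A w, C w)) + pmf_entropy q (\<lambda>w. (B w, C w))
    - pmf_entropy q (\<lambda>w. (A w, B w, C w)) - pmf_entropy q C"
proof -
  have "cond_mutual_info q A B C = mutual_info q A (\<lambda>w. (B w, C w)) - mutual_info q A C"
    unfolding cond_mutual_info_def mutual_info_def
      prob_space.conditional_mutual_information_def[OF prob_space_measure_pmf]
    by (simp add: pair_measure_countable)
  then show ?thesis by (simp add: mutual_info_eq_entropy[OF fin])
qed

text \<open>Dividing by the atom probability cancels the weights of the image distribution and
  leaves a plain sum over its support.\<close>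

lemma expectation_divide_atom_prob:
  fixes h :: "'a \<Rightarrow> real"
  assumes fin: "finite (set_pmf q)"
  shows "measure_pmf.expectation q (\<lambda>w. h (F w) / atom_prob q F w) = (\<Sum>a\<in>F ` set_pmf q. h a)"
proof -
  have "measure_pmf.expectation q (\<lambda>w. h (F w) / atom_prob q F w) =
    measure_pmf.expectation (map_pmf F q) (\<lambda>a. h a / pmf (map_pmf F q) a)"
    by (simp add: atom_prob_eq_pmf)
  also have "\<dots> = (\<Sum>a\<in>F ` set_pmf q. h a)"
    using fin by (subst expectation_finite) (auto intro!: sum.cong simp: atom_prob_eq_pmf[symmetric] atom_prob_pos[THEN less_imp_neq, symmetric])
  finally show ?thesis .
qed

lemma sum_pmf_map_pair:
  assumes fin: "finite (set_pmf q)" and D: "finite D" "F ` set_pmf q \<subseteq> D"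
  shows "(\<Sum>a\<in>D. pmf (map_pmf (\<lambda>w. (F w, G w)) q) (a, c)) = pmf (map_pmf G q) c"
proof -
  have "(\<Sum>a\<in>D. pmf (map_pmf (\<lambda>w. (F w, G w)) q) (a, c)) =
      (\<Sum>a\<in>D. measure_pmf.expectation q (\<lambda>w. of_bool (F w = a) * of_bool (G w = c)))"
    by (simp add: pmf_map prob_eq_expectation of_bool_conj)
  also have "\<dots> = measure_pmf.expectation q (\<lambda>w. \<Sum>a\<in>D. of_bool (F w = a) * of_bool (G w = c))"
    using fin by (simp add: integrable_measure_pmf_finite Bochner_Integration.integral_sum)
  also have "\<dots> = measure_pmf.expectation q (\<lambda>w. of_bool (G w = c))"
    using D by (intro expectation_cong_finite) (auto simp flip: sum_distrib_right)
  also have "\<dots> = pmf (map_pmf G q) c"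
    by (simp add: pmf_map prob_eq_expectation)
  finally show ?thesis .
qed

text \<open>Nonnegativity of I(A;B|C), by Gibbs' inequality: the true law is compared with
  \<open>r\<close>, which makes A and B conditionally independent given C, and ln t \<le> t - 1 is
  applied to the ratio.\<close>

lemma entropy_submodular:
  assumes fin: "finite (set_pmf q)"
  shows "pmf_entropy q (\<lambda>w. (A w, B w, C w)) + pmf_entropy q C
    \<le> pmf_entropy q (\<lambda>w. (A w, C w)) + pmf_entropy q (\<lambda>w. (B w, C w))"
proof -
  let ?AC = "\<lambda>w. (A w, C w)" and ?BC = "\<lambda>w. (B w, C w)" and ?ABC = "\<lambda>w. (A w, B w, C w)"
  let ?S = "set_pmf q"
  define r where "r = (\<lambda>(a, b, c). pmf (map_pmf ?AC q) (a, c) * pmf (map_pmf ?BC q) (b, c) / pmf (map_pmf C q) c)"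
  \<comment> \<open>Enlarging the support to a product lets the sum over \<open>a\<close> run first,
    where it is a marginalisation. The mass gained only weakens the bound, which needs total mass at
    most 1.\<close>
  have "(\<Sum>t\<in>?ABC ` ?S. r t) \<le> (\<Sum>t\<in>A ` ?S \<times> ?BC ` ?S. r t)"
    using fin by (intro sum_mono2) (auto simp: r_def)
  also have "\<dots> = (\<Sum>t\<in>?BC ` ?S. \<Sum>a\<in>A ` ?S. r (a, t))"
    by (simp add: sum.swap[of _ "A ` ?S"] sum.cartesian_product')
  also have "\<dots> = (\<Sum>t\<in>?BC ` ?S. pmf (map_pmf ?BC q) t)"
  proof (rule sum.cong[OF refl])
    fix t assume "t \<in> ?BC ` ?S"
    then obtain w where w: "w \<in> ?S" "t = (B w, C w)" by auto
    have "(\<Sum>a\<in>A ` ?S. r (a, t)) =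
      (\<Sum>a\<in>A ` ?S. pmf (map_pmf ?AC q) (a, C w)) * pmf (map_pmf ?BC q) t / pmf (map_pmf C q) (C w)"
      using w by (simp add: r_def sum_distrib_right sum_divide_distrib)
    also have "\<dots> = pmf (map_pmf ?BC q) t"
      using fin w atom_prob_pos[of w q C] by (simp add: sum_pmf_map_pair atom_prob_eq_pmf)
    finally show "(\<Sum>a\<in>A ` ?S. r (a, t)) = pmf (map_pmf ?BC q) t" .
  qed
  also have "\<dots> = 1"
    using fin by (intro sum_pmf_eq_1) auto
  finally have r: "(\<Sum>t\<in>?ABC ` ?S. r t) \<le> 1" .
  have "measure_pmf.expectation q (\<lambda>w. log 2 (atom_prob q ?AC w) + log 2 (atom_prob q ?BC w)
      - log 2 (atom_prob q ?ABC w) - log 2 (atom_prob q C w))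
    \<le> measure_pmf.expectation q (\<lambda>w. (r (?ABC w) / atom_prob q ?ABC w - 1) / ln 2)"
    using fin
  proof (rule expectation_mono_finite)
    fix w assume w: "w \<in> ?S"
    note [simp] = atom_prob_pos[OF w] atom_prob_pos[OF w, THEN less_imp_neq, symmetric]
    have r_w: "r (?ABC w) = atom_prob q ?AC w * atom_prob q ?BC w / atom_prob q C w"
      by (simp add: r_def atom_prob_eq_pmf)
    have "ln (r (?ABC w) / atom_prob q ?ABC w) \<le> r (?ABC w) / atom_prob q ?ABC w - 1"
      by (rule ln_le_minus_one) (simp add: r_w)
    moreover have "log 2 (atom_prob q ?AC w) + log 2 (atom_prob q ?BC w)
      - log 2 (atom_prob q ?ABC w) - log 2 (atom_prob q C w) = ln (r (?ABC w) / atom_prob q ?ABC w) / ln 2"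
      by (simp add: r_w log_def ln_mult ln_div add_divide_distrib diff_divide_distrib)
    ultimately show "log 2 (atom_prob q ?AC w) + log 2 (atom_prob q ?BC w)
      - log 2 (atom_prob q ?ABC w) - log 2 (atom_prob q C w)
      \<le> (r (?ABC w) / atom_prob q ?ABC w - 1) / ln 2" by (simp add: divide_right_mono)
  qed
  also have "\<dots> = ((\<Sum>t\<in>?ABC ` ?S. r t) - 1) / ln 2"
    using fin expectation_divide_atom_prob[OF fin, of r ?ABC]
    by (simp add: integrable_measure_pmf_finite)
  also have "\<dots> \<le> 0" using r by (simp add: divide_le_0_iff)
  finally show ?thesis
    using fin by (simp add: pmf_entropy_def integrable_measure_pmf_finite)
qed

section \<open>Mutual covering by a random codebook\<close>

text \<open>The square is a sum over two pairs of positions. Given the first pair, the mean of the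
  second factor is bounded by \<open>A3\<close>, \<open>A1\<close>, \<open>A2\<close> or
  \<open>A0\<close> according to whether the pairs share both words, only \<open>y\<close>, only
  \<open>z\<close>, or neither.\<close>

lemma double_sum_second_moment:
  fixes g :: "'a \<Rightarrow> 'b \<Rightarrow> real"
  assumes fin: "finite (set_pmf p)" "finite (set_pmf q)"
    and g: "\<And>y z. g y z \<ge> 0"
    and A3: "\<And>y z. y \<in> set_pmf p \<Longrightarrow> z \<in> set_pmf q \<Longrightarrow> g y z \<le> A3"
    and A1: "\<And>y. y \<in> set_pmf p \<Longrightarrow> measure_pmf.expectation q (g y) \<le> A1"
    and A2: "\<And>z. z \<in> set_pmf q \<Longrightarrow> measure_pmf.expectation p (\<lambda>y. g y z) \<le> A2"
    and A0: "measure_pmf.expectation p (\<lambda>y. measure_pmf.expectation q (g y)) \<le> A0"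
  shows "measure_pmf.expectation (replicate_pmf m p) (\<lambda>ys.
      measure_pmf.expectation (replicate_pmf n q) (\<lambda>zs. (\<Sum>y\<leftarrow>ys. \<Sum>z\<leftarrow>zs. g y z)\<^sup>2))
    \<le> (real m * real n * A3 + real m * (real n)\<^sup>2 * A1 + (real m)\<^sup>2 * real n * A2 + (real m)\<^sup>2 * (real n)\<^sup>2 * A0) *
      measure_pmf.expectation p (\<lambda>y. measure_pmf.expectation q (g y))"
proof -
  have square: "measure_pmf.expectation r (\<lambda>x. (h x)\<^sup>2) \<le> A * measure_pmf.expectation r h"
    if "finite (set_pmf r)" "\<And>x. h x \<ge> 0" "\<And>x. x \<in> set_pmf r \<Longrightarrow> h x \<le> A" for r :: "'b pmf" and h :: "'b \<Rightarrow> real" and A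
  proof -
    have "measure_pmf.expectation r (\<lambda>x. (h x)\<^sup>2) \<le> measure_pmf.expectation r (\<lambda>x. A * h x)"
      using that by (intro expectation_mono_finite) (auto simp: power2_eq_square mult_right_mono)
    then show ?thesis by simp
  qed
  \<comment> \<open>One factor of the mean is kept and the other replaced by its bound, so the
    estimate stays linear in the mean.\<close>
  have moment: "measure_pmf.expectation (replicate_pmf k r) (\<lambda>xs. (\<Sum>x\<leftarrow>xs. h x)\<^sup>2)
      \<le> (real k * A + (real k)\<^sup>2 * A') * measure_pmf.expectation r h"
    if "finite (set_pmf r)" "\<And>x. h x \<ge> 0" "\<And>x. x \<in> set_pmf r \<Longrightarrow> h x \<le> A"
      "measure_pmf.expectation r h \<le> A'" for r :: "'b pmf" and h :: "'b \<Rightarrow> real" and A A' k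
  proof -
    have nn: "measure_pmf.expectation r h \<ge> 0" using that by (intro Bochner_Integration.integral_nonneg) auto
    have "real k * (real k - 1) * (measure_pmf.expectation r h)\<^sup>2 \<le> (real k)\<^sup>2 * (A' * measure_pmf.expectation r h)"
      using that(4) nn by (intro mult_mono) (auto simp: power2_eq_square intro!: mult_left_mono mult_right_mono)
    moreover have "real k * measure_pmf.expectation r (\<lambda>x. (h x)\<^sup>2) \<le> real k * (A * measure_pmf.expectation r h)"
      using square[OF that(1-3)] by (intro mult_left_mono) auto
    ultimately show ?thesis
      using that(1) by (simp add: expectation_sum_replicate_square algebra_simps)
  qed
  define g' where "g' z = measure_pmf.expectation p (\<lambda>y. g y z)" for z
  have g': "g' z \<ge> 0" for z unfolding g'_def using g by (intro Bochner_Integration.integral_nonneg) auto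
  have Eg': "measure_pmf.expectation q g' = measure_pmf.expectation p (\<lambda>y. measure_pmf.expectation q (g y))"
    unfolding g'_def using fin by (intro expectation_swap)
  \<comment> \<open>For fixed \<open>zs\<close> the outer sum has i.i.d. terms in \<open>ys\<close>.
    This splits off the diagonal in \<open>y\<close>; each part is then a one-dimensional second
    moment in \<open>z\<close>.\<close>
  have "measure_pmf.expectation (replicate_pmf m p) (\<lambda>ys.
      measure_pmf.expectation (replicate_pmf n q) (\<lambda>zs. (\<Sum>y\<leftarrow>ys. \<Sum>z\<leftarrow>zs. g y z)\<^sup>2)) =
    measure_pmf.expectation (replicate_pmf n q) (\<lambda>zs. m * measure_pmf.expectation p (\<lambda>y. (\<Sum>z\<leftarrow>zs. g y z)\<^sup>2)
      + real m * (real m - 1) * (\<Sum>z\<leftarrow>zs. g' z)\<^sup>2)"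
    using fin by (subst expectation_swap)
      (simp_all add: expectation_sum_replicate_square expectation_sum_list g'_def[abs_def])
  also have "\<dots> = m * measure_pmf.expectation p (\<lambda>y.
        measure_pmf.expectation (replicate_pmf n q) (\<lambda>zs. (\<Sum>z\<leftarrow>zs. g y z)\<^sup>2))
      + real m * (real m - 1) * measure_pmf.expectation (replicate_pmf n q) (\<lambda>zs. (\<Sum>z\<leftarrow>zs. g' z)\<^sup>2)"
    using fin by (simp add: integrable_measure_pmf_finite expectation_swap[of p])
  also have "\<dots> \<le> m * measure_pmf.expectation p (\<lambda>y. (real n * A3 + (real n)\<^sup>2 * A1) * measure_pmf.expectation q (g y))
      + (real m)\<^sup>2 * ((real n * A2 + (real n)\<^sup>2 * A0) * measure_pmf.expectation q g')"
  proof (intro add_mono mult_left_mono expectation_mono_finite mult_mono)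
    show "measure_pmf.expectation (replicate_pmf n q) (\<lambda>zs. (\<Sum>z\<leftarrow>zs. g y z)\<^sup>2)
      \<le> (real n * A3 + (real n)\<^sup>2 * A1) * measure_pmf.expectation q (g y)" if "y \<in> set_pmf p" for y
      using fin g A3 A1 that by (intro moment) auto
    show "measure_pmf.expectation (replicate_pmf n q) (\<lambda>zs. (\<Sum>z\<leftarrow>zs. g' z)\<^sup>2)
      \<le> (real n * A2 + (real n)\<^sup>2 * A0) * measure_pmf.expectation q g'"
      using fin g' A2 A0 by (intro moment) (auto simp: g'_def[symmetric] Eg')
  qed (auto simp: fin power2_eq_square intro!: Bochner_Integration.integral_nonneg mult_left_mono)
  finally show ?thesis
    unfolding integral_mult_right_zero Eg' by (simp add: algebra_simps)
qed

text \<open>Given \<open>u\<close> the two lists are independent, since neither decoder sees the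
  private index of the other.\<close>

definition cluster_pmf ::
  "'u pmf \<Rightarrow> ('u \<Rightarrow> 'y pmf) \<Rightarrow> ('u \<Rightarrow> 'z pmf) \<Rightarrow> nat \<Rightarrow> nat \<Rightarrow> ('u \<times> 'y list \<times> 'z list) pmf" where
  "cluster_pmf Pu Py Pz m n =
     do {u \<leftarrow> Pu; ys \<leftarrow> replicate_pmf m (Py u); zs \<leftarrow> replicate_pmf n (Pz u); return_pmf (u, ys, zs)}"

text \<open>With S the sum of all weights in the cluster, 2tS - (tS)^2 is at most 1 and vanishes
  where S = 0, so its mean is a lower bound for the probability of a positive weight. No division by
  the mean of S occurs, so mean zero is no exception.\<close>

lemma cluster_covering:
  fixes g :: "'u \<Rightarrow> 'y \<Rightarrow> 'z \<Rightarrow> real" and m n :: nat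
  assumes fin: "finite (set_pmf Pu)" "\<And>u. finite (set_pmf (Py u))" "\<And>u. finite (set_pmf (Pz u))"
    and g: "\<And>u y z. g u y z \<ge> 0"
    and A3: "\<And>u y z. u \<in> set_pmf Pu \<Longrightarrow> g u y z \<le> A3"
    and A1: "\<And>u y. u \<in> set_pmf Pu \<Longrightarrow> measure_pmf.expectation (Pz u) (g u y) \<le> A1"
    and A2: "\<And>u z. u \<in> set_pmf Pu \<Longrightarrow> measure_pmf.expectation (Py u) (\<lambda>y. g u y z) \<le> A2"
    and A0: "\<And>u. u \<in> set_pmf Pu \<Longrightarrow>
      measure_pmf.expectation (Py u) (\<lambda>y. measure_pmf.expectation (Pz u) (g u y)) \<le> A0"
    and pos: "A0 > 0" "A1 > 0" "A2 > 0" "A3 > 0" "m > 0" "n > 0"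
  shows "measure_pmf.expectation Pu (\<lambda>u. measure_pmf.expectation (Py u) (\<lambda>y. measure_pmf.expectation (Pz u) (g u y)))
      / (A0 + A1 / m + A2 / n + A3 / (m * n))
    \<le> measure_pmf.prob (cluster_pmf Pu Py Pz m n) {(u, ys, zs). \<exists>y\<in>set ys. \<exists>z\<in>set zs. g u y z > 0}"
    (is "?G / ?B \<le> measure_pmf.prob ?C ?E")
proof -
  define B where "B = A0 + A1 / m + A2 / n + A3 / (m * n)"
  define G where "G = ?G"
  define S where "S = (\<lambda>(u, ys, zs). \<Sum>y\<leftarrow>ys. \<Sum>z\<leftarrow>zs. g u y z)"
  \<comment> \<open>For G > 0 this value maximises the lower bound 2t(mnG) - t^2 (mn)^2 BG, and the
    maximum is G / B.\<close>
  define t where "t = 1 / (real m * real n * B)"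
  have B: "B > 0" unfolding B_def using pos by (intro add_pos_pos divide_pos_pos) auto
  have EC: "measure_pmf.expectation ?C f = measure_pmf.expectation Pu (\<lambda>u.
      measure_pmf.expectation (replicate_pmf m (Py u)) (\<lambda>ys.
        measure_pmf.expectation (replicate_pmf n (Pz u)) (\<lambda>zs. f (u, ys, zs))))" for f :: "_ \<Rightarrow> real"
    using fin by (simp add: cluster_pmf_def expectation_bind)
  have finC: "finite (set_pmf ?C)"
    using fin by (auto simp: cluster_pmf_def)
  have S1: "measure_pmf.expectation ?C S = real m * real n * G"
    using fin by (simp add: EC S_def expectation_sum_list expectation_sum_replicate G_def mult.assoc)
  have "measure_pmf.expectation ?C (\<lambda>c. (S c)\<^sup>2) \<le> measure_pmf.expectation Pu (\<lambda>u.
     (real m * real n * A3 + real m * (real n)\<^sup>2 * A1 + (real m)\<^sup>2 * real n * A2 + (real m)\<^sup>2 * (real n)\<^sup>2 * A0) *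
      measure_pmf.expectation (Py u) (\<lambda>y. measure_pmf.expectation (Pz u) (g u y)))"
    unfolding EC S_def prod.case using assms
    by (intro expectation_mono_finite double_sum_second_moment) auto
  also have "real m * real n * A3 + real m * (real n)\<^sup>2 * A1 + (real m)\<^sup>2 * real n * A2
      + (real m)\<^sup>2 * (real n)\<^sup>2 * A0 = (real m * real n)\<^sup>2 * B"
    using pos by (simp add: B_def field_simps power2_eq_square)
  also have "measure_pmf.expectation Pu (\<lambda>u. (real m * real n)\<^sup>2 * B *
      measure_pmf.expectation (Py u) (\<lambda>y. measure_pmf.expectation (Pz u) (g u y))) = (real m * real n)\<^sup>2 * B * G"
    by (simp add: G_def)
  finally have S2: "measure_pmf.expectation ?C (\<lambda>c. (S c)\<^sup>2) \<le> (real m * real n)\<^sup>2 * B * G" .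
  have "G / B = 2 * t * (real m * real n * G) - t\<^sup>2 * ((real m * real n)\<^sup>2 * B * G)"
    using pos B by (simp add: t_def field_simps power2_eq_square)
  also have "\<dots> \<le> 2 * t * measure_pmf.expectation ?C S - t\<^sup>2 * measure_pmf.expectation ?C (\<lambda>c. (S c)\<^sup>2)"
    using S1 S2 by (simp add: mult_left_mono)
  also have "\<dots> = measure_pmf.expectation ?C (\<lambda>c. 2 * t * S c - t\<^sup>2 * (S c)\<^sup>2)"
    using finC by (simp add: integrable_measure_pmf_finite)
  also have "\<dots> \<le> measure_pmf.expectation ?C (\<lambda>c. of_bool (c \<in> ?E))"
    using finC
  proof (rule expectation_mono_finite)
    fix c
    show "2 * t * S c - t\<^sup>2 * (S c)\<^sup>2 \<le> of_bool (c \<in> ?E)"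
    proof (cases "c \<in> ?E")
      case True
      have "0 \<le> (t * S c - 1)\<^sup>2" by simp
      with True show ?thesis by (simp add: power2_eq_square algebra_simps)
    next
      case False
      obtain u ys zs where c: "c = (u, ys, zs)" by (cases c)
      have "g u y z = 0" if "y \<in> set ys" "z \<in> set zs" for y z
        using False that g[of u y z] by (auto simp: c order.antisym not_less)
      then have "(\<Sum>y\<leftarrow>ys. \<Sum>z\<leftarrow>zs. g u y z) = (\<Sum>y\<leftarrow>ys. \<Sum>z\<leftarrow>zs. 0)"
        by (intro arg_cong[of _ _ sum_list] map_cong) auto
      then have "S c = 0" by (simp add: S_def c)
      then show ?thesis by simp
    qed
  qed
  also have "\<dots> = measure_pmf.prob ?C ?E" by (simp add: prob_eq_expectation)
  finally show ?thesis by (simp add: G_def B_def)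
qed

text \<open>The default value covers unattained \<open>a\<close>, where \<open>cond_pmf\<close> is
  unspecified; it keeps the support finite for every argument.\<close>

definition cond_kernel :: "'o pmf \<Rightarrow> ('o \<Rightarrow> 'a) \<Rightarrow> ('o \<Rightarrow> 'b) \<Rightarrow> 'a \<Rightarrow> 'b pmf" where
  "cond_kernel q F H a = (if a \<in> F ` set_pmf q then map_pmf H (cond_pmf q {w. F w = a}) else return_pmf undefined)"

lemma set_cond_kernel:
  "a \<in> F ` set_pmf q \<Longrightarrow> set_pmf (cond_kernel q F H a) = H ` {w \<in> set_pmf q. F w = a}"
proof -
  assume a: "a \<in> F ` set_pmf q"
  then have "set_pmf q \<inter> {w. F w = a} \<noteq> {}" by auto
  then show ?thesis using a by (auto simp: cond_kernel_def)
qed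

lemma finite_set_cond_kernel: "finite (set_pmf q) \<Longrightarrow> finite (set_pmf (cond_kernel q F H a))"
  by (cases "a \<in> F ` set_pmf q") (simp_all add: set_cond_kernel, simp add: cond_kernel_def)

lemma pmf_cond_kernel:
  assumes "a \<in> F ` set_pmf q"
  shows "pmf (cond_kernel q F H a) b = measure_pmf.prob q {w. F w = a \<and> H w = b} / measure_pmf.prob q {w. F w = a}"
proof -
  have ne: "set_pmf q \<inter> {w. F w = a} \<noteq> {}" using assms by auto
  have "pmf (cond_kernel q F H a) b = measure_pmf.prob (cond_pmf q {w. F w = a}) (H -` {b})"
    using assms by (simp add: cond_kernel_def pmf_map)
  also have "\<dots> = measure_pmf.prob q ({w. F w = a} \<inter> H -` {b}) / measure_pmf.prob q {w. F w = a}"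
    unfolding cond_pmf.rep_eq[OF ne]
    by (rule measure_uniform_measure) (use emeasure_measure_pmf_not_zero[OF ne] in auto)
  finally show ?thesis by (simp add: Int_def vimage_def)
qed

text \<open>Integrates one coordinate out of a likelihood ratio: the conditional probability of
  \<open>b\<close> cancels the denominator, and the pieces of \<open>\<tau>\<close> over the values
  of \<open>H\<close> add up to \<open>\<tau>\<close>. It is applied in turn to z, y and u.\<close>

lemma expectation_cond_kernel:
  assumes fin: "finite (set_pmf q)" and a: "a \<in> F ` set_pmf q" and sub: "\<tau> \<subseteq> {w. F w = a}"
  shows "measure_pmf.expectation (cond_kernel q F H a)
      (\<lambda>b. measure_pmf.prob q {w \<in> \<tau>. H w = b} / measure_pmf.prob q {w. F w = a \<and> H w = b})
    = measure_pmf.prob q \<tau> / measure_pmf.prob q {w. F w = a}"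
proof -
  let ?D = "H ` {w \<in> set_pmf q. F w = a}"
  have "measure_pmf.expectation (cond_kernel q F H a)
      (\<lambda>b. measure_pmf.prob q {w \<in> \<tau>. H w = b} / measure_pmf.prob q {w. F w = a \<and> H w = b}) =
     (\<Sum>b\<in>?D. measure_pmf.prob q {w \<in> \<tau>. H w = b} / measure_pmf.prob q {w. F w = a})"
    using fin a
  proof (subst expectation_finite, simp add: finite_set_cond_kernel, intro sum.cong)
    fix b assume "b \<in> ?D"
    then obtain w where "w \<in> set_pmf q" "F w = a" "H w = b" by auto
    then have "measure_pmf.prob q {w. F w = a \<and> H w = b} > 0" by (auto intro!: measure_pmf_posI)
    then show "pmf (cond_kernel q F H a) b * (measure_pmf.prob q {w \<in> \<tau>. H w = b} / measure_pmf.prob q {w. F w = a \<and> H w = b})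
      = measure_pmf.prob q {w \<in> \<tau>. H w = b} / measure_pmf.prob q {w. F w = a}"
      using a by (simp add: pmf_cond_kernel)
  qed (simp add: set_cond_kernel)
  also have "(\<Sum>b\<in>?D. measure_pmf.prob q {w \<in> \<tau>. H w = b} / measure_pmf.prob q {w. F w = a}) =
     measure_pmf.prob q (\<Union>b\<in>?D. {w \<in> \<tau>. H w = b}) / measure_pmf.prob q {w. F w = a}"
    using fin unfolding sum_divide_distrib[symmetric]
    by (subst measure_pmf.finite_measure_finite_Union) (auto simp: disjoint_family_on_def)
  also have "measure_pmf.prob q (\<Union>b\<in>?D. {w \<in> \<tau>. H w = b}) = measure_pmf.prob q \<tau>"
    using sub by (intro measure_pmf.finite_measure_eq_AE) (auto simp: AE_measure_pmf_iff)
  finally show ?thesis .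
qed

text \<open>This crude decay suffices, since the failure probability only has to tend to 0.\<close>

lemma exp_minus_le_inverse:
  fixes x :: real
  assumes "x > 0"
  shows "exp (- x) \<le> 1 / x"
proof -
  have "x \<le> exp x" using exp_ge_add_one_self[of x] by linarith
  then show ?thesis using assms by (simp add: exp_minus inverse_eq_divide frac_le)
qed

text \<open>The expected number of codewords that match \<open>x\<close>, weighted by likelihood ratios, is controlled
  by its second moment. In that moment two triples of the same cluster share \<open>u\<close> only, \<open>(u, y)\<close>,
  \<open>(u, z)\<close> or \<open>(u, y, z)\<close>; these cases give the four terms of the bound.\<close>

lemma mutual_covering:
  fixes q :: "'o pmf" and X :: "'o \<Rightarrow> 'x" and U :: "'o \<Rightarrow> 'u" and Y :: "'o \<Rightarrow> 'y" and Z :: "'o \<Rightarrow> 'z"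
    and M0 M1 M2 :: nat
  assumes fin: "finite (set_pmf q)" and T: "T \<subseteq> set_pmf q"
    and pos: "A0 > 0" "A1 > 0" "A2 > 0" "A3 > 0" "M0 > 0" "M1 > 0" "M2 > 0"
    and A0: "\<And>w. w \<in> T \<Longrightarrow> atom_prob q (\<lambda>w. (X w, U w)) w \<le> A0 * (atom_prob q X w * atom_prob q U w)"
    and A1: "\<And>w. w \<in> T \<Longrightarrow> atom_prob q (\<lambda>w. (X w, U w, Y w)) w \<le>
      A1 * (atom_prob q X w * atom_prob q (\<lambda>w. (U w, Y w)) w)"
    and A2: "\<And>w. w \<in> T \<Longrightarrow> atom_prob q (\<lambda>w. (X w, U w, Z w)) w \<le>
      A2 * (atom_prob q X w * atom_prob q (\<lambda>w. (U w, Z w)) w)"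
    and A3: "\<And>w. w \<in> T \<Longrightarrow> atom_prob q (\<lambda>w. (X w, U w, Y w, Z w)) w * atom_prob q U w \<le>
      A3 * (atom_prob q X w * atom_prob q (\<lambda>w. (U w, Y w)) w * atom_prob q (\<lambda>w. (U w, Z w)) w)"
  shows "\<exists>y z. measure_pmf.prob (map_pmf X q)
      {x. \<not> (\<exists>k<M0. \<exists>a<M1. \<exists>b<M2. \<exists>w\<in>T. X w = x \<and> Y w = y k a \<and> Z w = z k b)}
    \<le> 2 * (A0 + A1 / M1 + A2 / M2 + A3 / (M1 * M2)) / M0 + 2 * (1 - measure_pmf.prob q T)"
proof -
  define P where "P A = measure_pmf.prob q A" for A
  \<comment> \<open>Conditioning on a constant gives the plain law of \<open>U\<close>, so the lemma
    that integrates out y and z also integrates out u.\<close>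
  define Pu where "Pu = cond_kernel q (\<lambda>_. True) U True"
  define Py where "Py = cond_kernel q U Y"
  define Pz where "Pz = cond_kernel q U Z"
  define B where "B = A0 + A1 / M1 + A2 / M2 + A3 / (M1 * M2)"
  \<comment> \<open>The ratio of p(u,y,z|x), restricted to \<open>T\<close>, to p(u) p(y|u) p(z|u),
    with the powers of p(u) collected in the numerator.\<close>
  define g where "g x u y z = P {w \<in> T. X w = x \<and> U w = u \<and> Y w = y \<and> Z w = z} * P {w. U w = u} /
    (P {w. X w = x} * P {w. U w = u \<and> Y w = y} * P {w. U w = u \<and> Z w = z})" for x u y z
  define G where "G x = P {w \<in> T. X w = x} / P {w. X w = x}" for x
  define C where "C = cluster_pmf Pu Py Pz M1 M2"
  define good where "good x = (\<lambda>(u :: 'u, ys, zs). \<exists>y\<in>set ys. \<exists>z\<in>set zs. \<exists>w\<in>T. X w = x \<and> Y w = y \<and> Z w = z)" for x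
  have B: "B > 0" unfolding B_def using pos by (intro add_pos_pos divide_pos_pos) auto
  have P_nonneg: "P A \<ge> 0" for A by (simp add: P_def)
  have finu: "finite (set_pmf Pu)" "\<And>u. finite (set_pmf (Py u))" "\<And>u. finite (set_pmf (Pz u))"
    unfolding Pu_def Py_def Pz_def by (rule finite_set_cond_kernel[OF fin])+
  have const: "True \<in> (\<lambda>_. True) ` set_pmf q"
    using set_pmf_not_empty[of q] by blast
  have setPu: "set_pmf Pu = U ` set_pmf q"
    using set_cond_kernel[OF const, of U] by (simp add: Pu_def)
  have Ez: "measure_pmf.expectation (Pz u) (g x u y) =
      P {w \<in> T. X w = x \<and> U w = u \<and> Y w = y} / (P {w. X w = x} * P {w. U w = u \<and> Y w = y})"
    if u: "u \<in> U ` set_pmf q" for x u y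
  proof -
    define \<tau> where "\<tau> = {w \<in> T. X w = x \<and> U w = u \<and> Y w = y}"
    have Pu_pos: "P {w. U w = u} > 0" unfolding P_def using u by (auto intro!: measure_pmf_posI)
    have "{w \<in> \<tau>. Z w = z} = {w \<in> T. X w = x \<and> U w = u \<and> Y w = y \<and> Z w = z}" for z
      by (auto simp: \<tau>_def)
    then have "measure_pmf.expectation (Pz u) (g x u y) = measure_pmf.expectation (Pz u)
        (\<lambda>z. P {w. U w = u} / (P {w. X w = x} * P {w. U w = u \<and> Y w = y}) *
          (measure_pmf.prob q {w \<in> \<tau>. Z w = z} / measure_pmf.prob q {w. U w = u \<and> Z w = z}))"
      by (intro expectation_cong_finite) (simp add: g_def P_def)
    also have "\<dots> = P {w. U w = u} / (P {w. X w = x} * P {w. U w = u \<and> Y w = y}) *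
        (P \<tau> / P {w. U w = u})"
      unfolding Pz_def integral_mult_right_zero P_def
      by (subst expectation_cond_kernel[OF fin u]) (auto simp: \<tau>_def)
    finally show ?thesis using Pu_pos by (simp add: \<tau>_def)
  qed
  have Ey: "measure_pmf.expectation (Py u) (\<lambda>y. g x u y z) =
      P {w \<in> T. X w = x \<and> U w = u \<and> Z w = z} / (P {w. X w = x} * P {w. U w = u \<and> Z w = z})"
    if u: "u \<in> U ` set_pmf q" for x u z
  proof -
    define \<tau> where "\<tau> = {w \<in> T. X w = x \<and> U w = u \<and> Z w = z}"
    have Pu_pos: "P {w. U w = u} > 0" unfolding P_def using u by (auto intro!: measure_pmf_posI)
    have "{w \<in> \<tau>. Y w = y} = {w \<in> T. X w = x \<and> U w = u \<and> Y w = y \<and> Z w = z}" for y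
      by (auto simp: \<tau>_def)
    then have "measure_pmf.expectation (Py u) (\<lambda>y. g x u y z) = measure_pmf.expectation (Py u)
        (\<lambda>y. P {w. U w = u} / (P {w. X w = x} * P {w. U w = u \<and> Z w = z}) *
          (measure_pmf.prob q {w \<in> \<tau>. Y w = y} / measure_pmf.prob q {w. U w = u \<and> Y w = y}))"
      by (intro expectation_cong_finite) (simp add: g_def P_def ac_simps)
    also have "\<dots> = P {w. U w = u} / (P {w. X w = x} * P {w. U w = u \<and> Z w = z}) *
        (P \<tau> / P {w. U w = u})"
      unfolding Py_def integral_mult_right_zero P_def
      by (subst expectation_cond_kernel[OF fin u]) (auto simp: \<tau>_def)
    finally show ?thesis using Pu_pos by (simp add: \<tau>_def)
  qed
  have Eyz: "measure_pmf.expectation (Py u) (\<lambda>y. measure_pmf.expectation (Pz u) (g x u y)) =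
      P {w \<in> T. X w = x \<and> U w = u} / (P {w. X w = x} * P {w. U w = u})"
    if u: "u \<in> U ` set_pmf q" for x u
  proof -
    define \<tau> where "\<tau> = {w \<in> T. X w = x \<and> U w = u}"
    have "measure_pmf.expectation (Py u) (\<lambda>y. measure_pmf.expectation (Pz u) (g x u y)) =
      measure_pmf.expectation (Py u) (\<lambda>y. 1 / P {w. X w = x} *
          (measure_pmf.prob q {w \<in> \<tau>. Y w = y} / measure_pmf.prob q {w. U w = u \<and> Y w = y}))"
      using u by (simp add: Ez \<tau>_def P_def conj_assoc)
    also have "\<dots> = 1 / P {w. X w = x} * (P \<tau> / P {w. U w = u})"
      unfolding Py_def integral_mult_right_zero P_def
      by (subst expectation_cond_kernel[OF fin u]) (auto simp: \<tau>_def)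
    finally show ?thesis by (simp add: \<tau>_def)
  qed
  have Euyz: "measure_pmf.expectation Pu (\<lambda>u. measure_pmf.expectation (Py u) (\<lambda>y. measure_pmf.expectation (Pz u) (g x u y))) = G x"
    for x
  proof -
    define \<tau> where "\<tau> = {w \<in> T. X w = x}"
    have "measure_pmf.expectation Pu (\<lambda>u. measure_pmf.expectation (Py u) (\<lambda>y. measure_pmf.expectation (Pz u) (g x u y))) =
      measure_pmf.expectation Pu (\<lambda>u. 1 / P {w. X w = x} *
          (measure_pmf.prob q {w \<in> \<tau>. U w = u} / measure_pmf.prob q {w. True = True \<and> U w = u}))"
      by (intro expectation_cong_finite) (simp add: setPu Eyz \<tau>_def P_def conj_assoc)
    also have "\<dots> = 1 / P {w. X w = x} * (P \<tau> / measure_pmf.prob q {w. True = True})"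
      unfolding Pu_def integral_mult_right_zero P_def
      by (subst expectation_cond_kernel[OF fin const]) auto
    finally show ?thesis by (simp add: \<tau>_def G_def)
  qed
  \<comment> \<open>If \<open>T'\<close> is empty or \<open>c = 0\<close>, the quotient is 0,
    division by zero included. Otherwise a point of \<open>T'\<close> supplies the bound on the
    whole fibre \<open>R\<close>.\<close>
  have fibre: "P T' / c \<le> A"
    if "A > 0" "T' \<subseteq> R" "\<And>v. v \<in> T' \<Longrightarrow> P R \<le> A * c" "c \<ge> 0" for T' R c A
  proof (cases "T' = {} \<or> c = 0")
    case False
    then have "P T' \<le> P R" unfolding P_def using that by (intro measure_pmf.finite_measure_mono) auto
    also have "\<dots> \<le> A * c" using False that(3) by auto
    finally show ?thesis using False that by (simp add: divide_le_eq)
  qed (use that in \<open>auto simp: P_def\<close>)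
  have cluster: "G x / B \<le> measure_pmf.prob C {c. good x c}" for x
  proof -
    have "G x / B \<le> measure_pmf.prob C {(u, ys, zs). \<exists>y\<in>set ys. \<exists>z\<in>set zs. g x u y z > 0}"
      unfolding Euyz[symmetric] B_def C_def
    proof (rule cluster_covering)
      show "g x u y z \<ge> 0" for u y z by (simp add: g_def P_nonneg)
      show "g x u y z \<le> A3" if "u \<in> set_pmf Pu" for u y z
      proof -
        have U_pos: "P {w. U w = u} > 0" unfolding P_def using that by (auto simp: setPu intro!: measure_pmf_posI)
        have "g x u y z = P {w \<in> T. X w = x \<and> U w = u \<and> Y w = y \<and> Z w = z} /
            (P {w. X w = x} * P {w. U w = u \<and> Y w = y} * P {w. U w = u \<and> Z w = z} / P {w. U w = u})"
          by (simp add: g_def)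
        also have "\<dots> \<le> A3"
        proof (rule fibre[where R = "{w. X w = x \<and> U w = u \<and> Y w = y \<and> Z w = z}"])
          fix v assume "v \<in> {w \<in> T. X w = x \<and> U w = u \<and> Y w = y \<and> Z w = z}"
          then have "P {w. X w = x \<and> U w = u \<and> Y w = y \<and> Z w = z} * P {w. U w = u} \<le>
            A3 * (P {w. X w = x} * P {w. U w = u \<and> Y w = y} * P {w. U w = u \<and> Z w = z})"
            using A3[of v] by (simp add: atom_prob_def P_def)
          then show "P {w. X w = x \<and> U w = u \<and> Y w = y \<and> Z w = z} \<le>
            A3 * (P {w. X w = x} * P {w. U w = u \<and> Y w = y} * P {w. U w = u \<and> Z w = z} / P {w. U w = u})"
            using U_pos by (simp add: le_divide_eq)
        qed (use pos in \<open>auto simp: P_nonneg\<close>)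
        finally show ?thesis .
      qed
      show "measure_pmf.expectation (Pz u) (g x u y) \<le> A1" if "u \<in> set_pmf Pu" for u y
        unfolding Ez[OF that[unfolded setPu]]
      proof (rule fibre[where R = "{w. X w = x \<and> U w = u \<and> Y w = y}"])
        fix v assume "v \<in> {w \<in> T. X w = x \<and> U w = u \<and> Y w = y}"
        then show "P {w. X w = x \<and> U w = u \<and> Y w = y} \<le> A1 * (P {w. X w = x} * P {w. U w = u \<and> Y w = y})"
          using A1[of v] by (simp add: atom_prob_def P_def)
      qed (use pos in \<open>auto simp: P_nonneg\<close>)
      show "measure_pmf.expectation (Py u) (\<lambda>y. g x u y z) \<le> A2" if "u \<in> set_pmf Pu" for u z
        unfolding Ey[OF that[unfolded setPu]]
      proof (rule fibre[where R = "{w. X w = x \<and> U w = u \<and> Z w = z}"])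
        fix v assume "v \<in> {w \<in> T. X w = x \<and> U w = u \<and> Z w = z}"
        then show "P {w. X w = x \<and> U w = u \<and> Z w = z} \<le> A2 * (P {w. X w = x} * P {w. U w = u \<and> Z w = z})"
          using A2[of v] by (simp add: atom_prob_def P_def)
      qed (use pos in \<open>auto simp: P_nonneg\<close>)
      show "measure_pmf.expectation (Py u) (\<lambda>y. measure_pmf.expectation (Pz u) (g x u y)) \<le> A0"
        if "u \<in> set_pmf Pu" for u
        unfolding Eyz[OF that[unfolded setPu]]
      proof (rule fibre[where R = "{w. X w = x \<and> U w = u}"])
        fix v assume "v \<in> {w \<in> T. X w = x \<and> U w = u}"
        then show "P {w. X w = x \<and> U w = u} \<le> A0 * (P {w. X w = x} * P {w. U w = u})"
          using A0[of v] by (simp add: atom_prob_def P_def)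
      qed (use pos in \<open>auto simp: P_nonneg\<close>)
    qed (use pos finu in auto)
    also have "\<dots> \<le> measure_pmf.prob C {c. good x c}"
    proof (intro measure_pmf.finite_measure_mono subsetI, clarsimp)
      fix u ys zs y z assume yz: "y \<in> set ys" "z \<in> set zs" "0 < g x u y z"
      then have "{w \<in> T. X w = x \<and> U w = u \<and> Y w = y \<and> Z w = z} \<noteq> {}"
        by (auto simp only: g_def P_def measure_empty mult_zero_left div_0)
      then show "good x (u, ys, zs)" using yz unfolding good_def by auto
    qed auto
    finally show ?thesis .
  qed
  have finC: "finite (set_pmf C)"
    unfolding C_def cluster_pmf_def using finu by auto
  \<comment> \<open>The factors 2 come from splitting at G x = 1/2. Below it the second summand
    already exceeds 1; above it each of the \<open>M0\<close> independent clusters succeeds with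
    probability at least 1 / (2B).\<close>
  have fail: "measure_pmf.prob (replicate_pmf M0 C) {cs. \<forall>c\<in>set cs. \<not> good x c} \<le> 2 * B / M0 + 2 * (1 - G x)" for x
  proof (cases "G x \<ge> 1 / 2")
    case True
    define \<pi> where "\<pi> = measure_pmf.prob C {c. good x c}"
    have "1 / (2 * B) \<le> G x / B" using True B by (simp add: field_simps)
    also have "\<dots> \<le> \<pi>" unfolding \<pi>_def by (rule cluster)
    finally have \<pi>: "1 / (2 * B) \<le> \<pi>" .
    then have \<pi>_pos: "\<pi> > 0" using B by (smt (verit) divide_pos_pos)
    have "measure_pmf.prob C {c. \<not> good x c} = 1 - \<pi>"
      unfolding \<pi>_def using measure_pmf.prob_compl[of "{c. good x c}" C] by (simp add: Compl_eq_Diff_UNIV[symmetric] Collect_neg_eq)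
    then have "measure_pmf.prob (replicate_pmf M0 C) {cs. \<forall>c\<in>set cs. \<not> good x c} = (1 - \<pi>) ^ M0"
      using finC by (simp add: prob_replicate_forall)
    also have "\<dots> \<le> exp (- \<pi>) ^ M0"
      using exp_ge_add_one_self[of "- \<pi>"] by (intro power_mono) (auto simp: \<pi>_def)
    also have "\<dots> = exp (- (M0 * \<pi>))" by (simp add: exp_of_nat_mult[symmetric])
    also have "\<dots> \<le> 1 / (M0 * \<pi>)" using \<pi>_pos pos by (intro exp_minus_le_inverse) simp
    also have "\<dots> \<le> 1 / (M0 * (1 / (2 * B)))" using \<pi> \<pi>_pos pos B by (intro divide_left_mono mult_left_mono) auto
    also have "\<dots> = 2 * B / M0" by simp
    also have "\<dots> \<le> 2 * B / M0 + 2 * (1 - G x)"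
    proof -
      have "P {w \<in> T. X w = x} \<le> P {w. X w = x}"
        unfolding P_def by (intro measure_pmf.finite_measure_mono) auto
      then have "G x \<le> 1" unfolding G_def using P_nonneg[of "{w. X w = x}"] by (auto simp: divide_le_eq_1 less_le)
      then show ?thesis by simp
    qed
    finally show ?thesis .
  next
    case False
    have "measure_pmf.prob (replicate_pmf M0 C) {cs. \<forall>c\<in>set cs. \<not> good x c} \<le> 1" by simp
    moreover have "2 * B / M0 \<ge> 0" using B by simp
    moreover have "1 \<le> 2 * (1 - G x)" using False by simp
    ultimately show ?thesis by (meson add_increasing order.trans)
  qed
  \<comment> \<open>\<open>G x\<close> is the conditional probability of \<open>T\<close> given x,
    so averaging over x restores the probability of \<open>T\<close>.\<close>
  have EG: "measure_pmf.expectation (map_pmf X q) G = P T"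
  proof -
    have "measure_pmf.expectation (map_pmf X q) G = measure_pmf.expectation q (\<lambda>w. P {v \<in> T. X v = X w} / atom_prob q X w)"
      by (simp add: G_def[abs_def] atom_prob_def P_def)
    also have "\<dots> = (\<Sum>a\<in>X ` set_pmf q. P {v \<in> T. X v = a})"
      using fin by (rule expectation_divide_atom_prob)
    also have "\<dots> = P (\<Union>a\<in>X ` set_pmf q. {v \<in> T. X v = a})"
      unfolding P_def using fin
      by (subst measure_pmf.finite_measure_finite_Union) (auto simp: disjoint_family_on_def)
    also have "(\<Union>a\<in>X ` set_pmf q. {v \<in> T. X v = a}) = T" using T by auto
    finally show ?thesis .
  qed
  \<comment> \<open>Exchanging the averages over codebooks and over x allows one codebook to be
    fixed for all x.\<close>
  have "measure_pmf.expectation (replicate_pmf M0 C)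
      (\<lambda>cs. measure_pmf.prob (map_pmf X q) {x. \<forall>c\<in>set cs. \<not> good x c}) =
    measure_pmf.expectation (map_pmf X q)
      (\<lambda>x. measure_pmf.prob (replicate_pmf M0 C) {cs. \<forall>c\<in>set cs. \<not> good x c})"
    unfolding prob_eq_expectation using finC fin by (subst expectation_swap) simp_all
  also have "\<dots> \<le> measure_pmf.expectation (map_pmf X q) (\<lambda>x. 2 * B / M0 + 2 * (1 - G x))"
    using fin fail by (intro expectation_mono_finite) auto
  also have "\<dots> = 2 * B / M0 + 2 * (1 - P T)"
    using fin unfolding EG[symmetric] by (simp add: integrable_measure_pmf_finite del: integral_map_pmf)
  finally obtain cs where cs: "cs \<in> set_pmf (replicate_pmf M0 C)"
      "measure_pmf.prob (map_pmf X q) {x. \<forall>c\<in>set cs. \<not> good x c} \<le> 2 * B / M0 + 2 * (1 - P T)"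
    using exists_le_expectation[OF finite_set_replicate_pmf[OF finC],
      of M0 "\<lambda>cs. measure_pmf.prob (map_pmf X q) {x. \<forall>c\<in>set cs. \<not> good x c}"] by fastforce
  have len: "length cs = M0" "\<And>u ys zs. (u, ys, zs) \<in> set cs \<Longrightarrow> length ys = M1 \<and> length zs = M2"
    using cs(1) by (fastforce simp: set_replicate_pmf C_def cluster_pmf_def)+
  have "measure_pmf.prob (map_pmf X q) {x. \<not> (\<exists>k<M0. \<exists>a<M1. \<exists>b<M2. \<exists>w\<in>T. X w = x \<and>
      Y w = fst (snd (cs ! k)) ! a \<and> Z w = snd (snd (cs ! k)) ! b)}
    \<le> measure_pmf.prob (map_pmf X q) {x. \<forall>c\<in>set cs. \<not> good x c}"
  proof (intro measure_pmf.finite_measure_mono subsetI CollectI ballI notI)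
    fix x c
    assume x: "x \<in> {x. \<not> (\<exists>k<M0. \<exists>a<M1. \<exists>b<M2. \<exists>w\<in>T. X w = x \<and>
      Y w = fst (snd (cs ! k)) ! a \<and> Z w = snd (snd (cs ! k)) ! b)}" and c: "c \<in> set cs" "good x c"
    obtain u ys zs where uyz: "c = (u, ys, zs)" by (cases c)
    obtain k where k: "k < M0" "cs ! k = c" using c len by (auto simp: in_set_conv_nth)
    obtain y z w where w: "y \<in> set ys" "z \<in> set zs" "w \<in> T" "X w = x" "Y w = y" "Z w = z"
      using c(2) unfolding good_def uyz by auto
    obtain a b where "a < M1" "ys ! a = y" "b < M2" "zs ! b = z"
      using w(1,2) len(2) c(1) unfolding uyz by (metis in_set_conv_nth)
    then show False using x k w uyz by auto
  qed auto
  also note cs(2)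
  finally show ?thesis
    unfolding B_def P_def
    by (intro exI[of _ "\<lambda>k a. fst (snd (cs ! k)) ! a"] exI[of _ "\<lambda>k b. snd (snd (cs ! k)) ! b"])
qed

section \<open>Outer bound\<close>

text \<open>Set to 0 on negative arguments as well, which makes it continuous on the whole real
  line.\<close>

definition xlog2 :: "real \<Rightarrow> real" where
  "xlog2 t = (if t > 0 then t * log 2 t else 0)"

text \<open>Applying ln s \<le> s - 1 to s = 1 / sqrt t gives - ln t \<le> 2 / sqrt t, hence a bound
  of order sqrt t.\<close>

lemma xlog2_tendsto_0: "(xlog2 \<longlongrightarrow> 0) (at 0)"
proof (rule Lim_null_comparison)
  have "norm (xlog2 t) \<le> 2 * sqrt \<bar>t\<bar> / ln 2" if "\<bar>t\<bar> < 1" for t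
  proof (cases "t > 0")
    case True
    have "ln (1 / sqrt t) \<le> 1 / sqrt t - 1" using True by (intro ln_le_minus_one) simp
    then have "- ln t \<le> 2 / sqrt t" using True by (simp add: ln_div ln_sqrt)
    then have "t * - ln t \<le> t * (2 / sqrt t)" using True by (intro mult_left_mono) auto
    also have "\<dots> = 2 * sqrt t" using True by (simp add: field_simps)
    finally have "- (t * ln t) \<le> 2 * sqrt t" by simp
    moreover have "ln t \<le> 0" using that True by simp
    then have "t * ln t \<le> 0" using True by (simp add: mult_le_0_iff)
    ultimately have "\<bar>t * ln t\<bar> \<le> 2 * sqrt t" by simp
    then have "\<bar>t * ln t\<bar> / ln 2 \<le> 2 * sqrt t / ln 2" by (intro divide_right_mono) auto
    then show ?thesis using True by (simp add: xlog2_def log_def abs_mult)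
  qed (simp add: xlog2_def)
  then show "\<forall>\<^sub>F t in at 0. norm (xlog2 t) \<le> 2 * sqrt \<bar>t\<bar> / ln 2"
    by (intro eventually_at[THEN iffD2] exI[of _ 1]) (auto simp: dist_real_def)
  have "((\<lambda>t. 2 * sqrt \<bar>t\<bar> / ln 2) \<longlongrightarrow> 2 * sqrt \<bar>0\<bar> / ln 2) (at (0::real))"
    by (intro tendsto_intros) auto
  then show "((\<lambda>t. 2 * sqrt \<bar>t\<bar> / ln 2) \<longlongrightarrow> 0) (at (0::real))" by simp
qed

lemma isCont_xlog2: "isCont xlog2 t"
proof (cases t "0 :: real" rule: linorder_cases)
  case less
  have "isCont xlog2 t \<longleftrightarrow> isCont (\<lambda>t. 0 :: real) t"
    using less eventually_nhds_in_open[of "{..<0}" t]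
    by (intro isCont_cong) (auto simp: xlog2_def elim: eventually_mono)
  then show ?thesis by simp
next
  case equal
  then show ?thesis using xlog2_tendsto_0 by (simp add: isCont_def xlog2_def)
next
  case greater
  have "isCont xlog2 t \<longleftrightarrow> isCont (\<lambda>t. t * log 2 t) t"
    using greater eventually_nhds_in_open[of "{0<..}" t]
    by (intro isCont_cong) (auto simp: xlog2_def elim: eventually_mono)
  then show ?thesis using greater by (auto intro!: continuous_intros)
qed

text \<open>For a joint distribution \<open>r\<close>, supported where \<open>p\<close> is positive,
  this is the mean of log(r(a|b) / p(a)), which is mutual information when the first marginal of
  \<open>r\<close> is \<open>p\<close>. Every varying logarithm is hidden in \<open>xlog2\<close>;
  the only bare one has the fixed argument \<open>pmf p a\<close>.\<close>

definition table_info :: "'a::finite pmf \<Rightarrow> ('a \<Rightarrow> 'b::finite \<Rightarrow> real) \<Rightarrow> real" where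
  "table_info p r = (\<Sum>a\<in>UNIV. \<Sum>b\<in>UNIV. xlog2 (r a b)) - (\<Sum>b\<in>UNIV. xlog2 (\<Sum>a\<in>UNIV. r a b))
    - (\<Sum>a\<in>UNIV. (\<Sum>b\<in>UNIV. r a b) * log 2 (pmf p a))"

lemma tendsto_table_info:
  assumes "\<And>a b. ((\<lambda>i. r i a b) \<longlongrightarrow> s a b) F"
  shows "((\<lambda>i. table_info p (r i)) \<longlongrightarrow> table_info p s) F"
  unfolding table_info_def
  by (intro tendsto_diff tendsto_sum isCont_tendsto_compose[OF isCont_xlog2] tendsto_mult assms tendsto_const)

text \<open>For a fixed sequence \<open>y\<close> the positions are independent, so the mean factors
  into means at most 1.\<close>

lemma expectation_prod_replicate_le_1:
  fixes \<phi> :: "'a \<Rightarrow> 'b \<Rightarrow> real"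
  assumes fin: "finite (set_pmf p)" and \<phi>: "\<And>a b. \<phi> a b \<ge> 0" "\<And>b. measure_pmf.expectation p (\<lambda>a. \<phi> a b) \<le> 1"
  shows "measure_pmf.expectation (replicate_pmf n p) (\<lambda>xs. \<Prod>k<n. \<phi> (xs ! k) (y k)) \<le> 1"
proof (induction n arbitrary: y)
  case (Suc n)
  have "measure_pmf.expectation (replicate_pmf (Suc n) p) (\<lambda>xs. \<Prod>k<Suc n. \<phi> (xs ! k) (y k)) =
    measure_pmf.expectation p (\<lambda>x. \<phi> x (y 0)) *
    measure_pmf.expectation (replicate_pmf n p) (\<lambda>xs. \<Prod>k<n. \<phi> (xs ! k) (y (Suc k)))"
    using fin by (simp add: expectation_replicate_Suc prod.lessThan_Suc_shift del: replicate_pmf.simps prod.lessThan_Suc)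
  also have "\<dots> \<le> 1 * 1"
    using \<phi> Suc[of "\<lambda>k. y (Suc k)"]
    by (intro mult_mono) (auto intro!: Bochner_Integration.integral_nonneg prod_nonneg)
  finally show ?case by simp
qed simp

text \<open>The joint law of source and output letter at a uniformly random position. The output
  \<open>d xs k\<close> may depend on the whole block; averaging over positions reduces this to
  single letters.\<close>

definition mean_table :: "'a pmf \<Rightarrow> nat \<Rightarrow> ('a list \<Rightarrow> nat \<Rightarrow> 'b) \<Rightarrow> 'a \<Rightarrow> 'b \<Rightarrow> real" where
  "mean_table p n d a b =
     measure_pmf.expectation (replicate_pmf n p) (\<lambda>xs. 1 / n * (\<Sum>k<n. of_bool (xs ! k = a \<and> d xs k = b)))"

text \<open>With \<open>L\<close> the product over the positions of the likelihood ratios of the mean table, the left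
  hand side is the mean of \<open>log L\<close>. For each fixed codeword the mean of \<open>L\<close> is at most \<open>1\<close>, and
  there are \<open>card S\<close> codewords.\<close>

lemma table_info_mean_table_le:
  fixes p :: "'a::finite pmf" and c :: "'m \<Rightarrow> nat \<Rightarrow> 'b::finite"
  assumes n: "n > 0" and S: "finite S" and e: "\<And>xs. length xs = n \<Longrightarrow> e xs \<in> S"
  shows "n * table_info p (mean_table p n (\<lambda>xs. c (e xs))) \<le> log 2 (card S)"
proof -
  let ?E = "measure_pmf.expectation (replicate_pmf n p)"
  define r where "r = mean_table p n (\<lambda>xs. c (e xs))"
  define rb where "rb b = (\<Sum>a\<in>UNIV. r a b)" for b
  define \<phi> where "\<phi> a b = r a b / (rb b * pmf p a)" for a b
  define L where "L xs m = (\<Prod>k<n. \<phi> (xs ! k) (c m k))" for xs m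
  have fin: "finite (set_pmf p)" by simp
  have r_nonneg: "r a b \<ge> 0" for a b
    unfolding r_def mean_table_def by (intro Bochner_Integration.integral_nonneg) (auto intro!: divide_nonneg_nonneg sum_nonneg)
  have rb_nonneg: "rb b \<ge> 0" for b unfolding rb_def by (intro sum_nonneg r_nonneg)
  have r_le_rb: "r a b \<le> rb b" for a b unfolding rb_def using r_nonneg by (intro member_le_sum) auto
  have \<phi>_nonneg: "\<phi> a b \<ge> 0" for a b by (simp add: \<phi>_def r_nonneg rb_nonneg)
  have len: "length xs = n" "set xs \<subseteq> set_pmf p" if "xs \<in> set_pmf (replicate_pmf n p)" for xs
    using that by (auto simp: set_replicate_pmf)
  \<comment> \<open>A block of positive probability itself contributes to the table entries of its
    pairs. All logarithms along such blocks are therefore of positive numbers.\<close>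
  have r_pos: "r (xs ! k) (c (e xs) k) > 0" if "xs \<in> set_pmf (replicate_pmf n p)" "k < n" for xs k
  proof -
    let ?f = "\<lambda>vs. 1 / n * (\<Sum>l<n. of_bool (vs ! l = xs ! k \<and> c (e vs) l = c (e xs) k))"
    have "(\<Sum>l<n. of_bool (xs ! l = xs ! k \<and> c (e xs) l = c (e xs) k)) \<ge> (of_bool (xs ! k = xs ! k \<and> c (e xs) k = c (e xs) k) :: real)"
      using that by (intro member_le_sum) auto
    then have "?f xs > 0" using n by simp
    then have "0 < pmf (replicate_pmf n p) xs * ?f xs"
      by (rule mult_pos_pos[OF pmf_positive[OF that(1)]])
    also have "\<dots> \<le> (\<Sum>vs\<in>set_pmf (replicate_pmf n p). pmf (replicate_pmf n p) vs * ?f vs)"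
      using that fin by (intro member_le_sum) (auto intro!: mult_nonneg_nonneg divide_nonneg_nonneg sum_nonneg)
    also have "\<dots> = r (xs ! k) (c (e xs) k)"
      unfolding r_def mean_table_def using fin by (intro expectation_finite[symmetric]) simp
    finally show ?thesis .
  qed
  have p_pos: "pmf p a > 0" if "r a b > 0" for a b
  proof (rule ccontr)
    assume "\<not> ?thesis"
    then have "a \<notin> set_pmf p" by (simp add: pmf_positive_iff)
    then have "r a b = ?E (\<lambda>xs. 0)"
      unfolding r_def mean_table_def
      by (intro expectation_cong_finite) (use len in \<open>force intro!: sum.neutral\<close>)
    then show False using that by simp
  qed
  \<comment> \<open>The weights p(a) cancel and leave r(a|b), which sums to at most 1; for a letter
    \<open>b\<close> of mass zero all quotients are 0.\<close>
  have \<phi>_mean: "measure_pmf.expectation p (\<lambda>a. \<phi> a b) \<le> 1" for b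
  proof -
    have "measure_pmf.expectation p (\<lambda>a. \<phi> a b) = (\<Sum>a\<in>set_pmf p. pmf p a * \<phi> a b)"
      by (rule expectation_finite) simp
    also have "\<dots> = (\<Sum>a\<in>set_pmf p. r a b / rb b)"
      by (intro sum.cong) (auto simp: \<phi>_def pmf_eq_0_set_pmf)
    also have "\<dots> \<le> (\<Sum>a\<in>UNIV. r a b / rb b)"
      by (intro sum_mono2) (auto simp: r_nonneg rb_nonneg)
    also have "\<dots> = rb b / rb b" unfolding sum_divide_distrib[symmetric] rb_def ..
    also have "\<dots> \<le> 1" by simp
    finally show ?thesis .
  qed
  have L_pos: "L xs (e xs) > 0" and \<phi>_pos: "k < n \<Longrightarrow> \<phi> (xs ! k) (c (e xs) k) > 0"
    if "xs \<in> set_pmf (replicate_pmf n p)" for xs k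
  proof -
    show *: "k < n \<Longrightarrow> \<phi> (xs ! k) (c (e xs) k) > 0" for k
      unfolding \<phi>_def using r_pos[OF that, of k] r_le_rb p_pos less_le_trans by (intro divide_pos_pos mult_pos_pos) blast+
    show "L xs (e xs) > 0" unfolding L_def by (intro prod_pos) (auto intro: *)
  qed
  have card: "card S > 0"
    using S e[of "replicate n undefined"] by (auto simp: card_gt_0_iff)
  have log_L: "log 2 (L xs (e xs)) = (\<Sum>k<n. \<Sum>a\<in>UNIV. \<Sum>b\<in>UNIV. of_bool (xs ! k = a \<and> c (e xs) k = b) * log 2 (\<phi> a b))"
    if "xs \<in> set_pmf (replicate_pmf n p)" for xs
  proof -
    have "log 2 (L xs (e xs)) = (\<Sum>k<n. log 2 (\<phi> (xs ! k) (c (e xs) k)))"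
      unfolding L_def log_def using \<phi>_pos[OF that]
      by (subst ln_prod) (fastforce simp: sum_divide_distrib)+
    then show ?thesis by (simp add: of_bool_conj sum_distrib_left[symmetric] mult.assoc)
  qed
  have "n * table_info p r = n * (\<Sum>a\<in>UNIV. \<Sum>b\<in>UNIV. r a b * log 2 (\<phi> a b))"
  proof -
    have summand: "r a b * log 2 (\<phi> a b) = xlog2 (r a b) - r a b * log 2 (rb b) - r a b * log 2 (pmf p a)" for a b
    proof (cases "r a b > 0")
      case True
      then have "rb b > 0" "pmf p a > 0" using r_le_rb[of a b] p_pos by auto
      with True show ?thesis by (simp add: \<phi>_def xlog2_def log_divide log_mult algebra_simps)
    next
      case False
      then have "r a b = 0" using r_nonneg[of a b] by simp
      then show ?thesis by (simp add: xlog2_def)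
    qed
    have "xlog2 (rb b) = (\<Sum>a\<in>UNIV. r a b * log 2 (rb b))" for b
    proof -
      have "xlog2 (rb b) = rb b * log 2 (rb b)"
        using rb_nonneg[of b] by (auto simp: xlog2_def less_le)
      also have "\<dots> = (\<Sum>a\<in>UNIV. r a b * log 2 (rb b))"
        by (subst (1) rb_def) (rule sum_distrib_right)
      finally show ?thesis .
    qed
    then have "(\<Sum>b\<in>UNIV. xlog2 (rb b)) = (\<Sum>a\<in>UNIV. \<Sum>b\<in>UNIV. r a b * log 2 (rb b))"
      by (simp add: sum.swap[of _ "UNIV :: 'b set"])
    then show ?thesis
      unfolding table_info_def rb_def[symmetric]
      by (simp add: summand sum_subtractf sum_distrib_right)
  qed
  also have "\<dots> = (\<Sum>a\<in>UNIV. \<Sum>b\<in>UNIV. n * r a b * log 2 (\<phi> a b))"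
    by (simp add: sum_distrib_left mult.assoc)
  also have "\<dots> = (\<Sum>a\<in>UNIV. \<Sum>b\<in>UNIV. ?E (\<lambda>xs. \<Sum>k<n. of_bool (xs ! k = a \<and> c (e xs) k = b) * log 2 (\<phi> a b)))"
    using n by (simp add: r_def mean_table_def sum_distrib_right[symmetric])
  also have "\<dots> = ?E (\<lambda>xs. log 2 (L xs (e xs)))"
  proof -
    have "?E (\<lambda>xs. log 2 (L xs (e xs))) = ?E (\<lambda>xs. \<Sum>a\<in>UNIV. \<Sum>b\<in>UNIV. \<Sum>k<n. of_bool (xs ! k = a \<and> c (e xs) k = b) * log 2 (\<phi> a b))"
      by (intro expectation_cong_finite)
         (simp only: log_L sum.swap[of _ "{..<n}" UNIV])
    then show ?thesis using fin by (simp add: integrable_measure_pmf_finite Bochner_Integration.integral_sum)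
  qed
  \<comment> \<open>Jensen's inequality in tangent form, ln t \<le> t - 1 at t = L / card S.
    Replacing the chosen codeword by the sum over all codewords removes the encoder, so each term
    has a fixed codeword.\<close>
  also have "\<dots> \<le> ?E (\<lambda>xs. log 2 (card S) + ((\<Sum>m\<in>S. L xs m) / card S - 1) / ln 2)"
  proof (rule expectation_mono_finite)
    fix xs assume xs: "xs \<in> set_pmf (replicate_pmf n p)"
    have "ln (L xs (e xs) / card S) \<le> L xs (e xs) / card S - 1"
      using L_pos[OF xs] card by (intro ln_le_minus_one) simp
    also have "\<dots> \<le> (\<Sum>m\<in>S. L xs m) / card S - 1"
      using S e[of xs] len[OF xs]
      by (intro diff_right_mono divide_right_mono member_le_sum) (auto simp: L_def intro!: prod_nonneg \<phi>_nonneg)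
    finally have "ln (L xs (e xs) / card S) / ln 2 \<le> ((\<Sum>m\<in>S. L xs m) / card S - 1) / ln 2"
      by (intro divide_right_mono) auto
    then show "log 2 (L xs (e xs)) \<le> log 2 (card S) + ((\<Sum>m\<in>S. L xs m) / card S - 1) / ln 2"
      using L_pos[OF xs] card by (simp add: log_def ln_div diff_divide_distrib)
  qed (simp add: fin)
  also have "\<dots> = log 2 (card S) + ((\<Sum>m\<in>S. ?E (\<lambda>xs. L xs m)) / card S - 1) / ln 2"
    using fin by (simp add: integrable_measure_pmf_finite Bochner_Integration.integral_sum)
  also have "\<dots> \<le> log 2 (card S)"
  proof -
    have "(\<Sum>m\<in>S. ?E (\<lambda>xs. L xs m)) \<le> (\<Sum>m\<in>S. 1)"
      unfolding L_def using \<phi>_nonneg \<phi>_mean by (intro sum_mono expectation_prod_replicate_le_1) auto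
    then show ?thesis using card by (simp add: divide_le_0_iff)
  qed
  finally show ?thesis by (simp add: r_def)
qed

section \<open>Mutual information as a continuous function of the kernel table\<close>

lemma pmf_entropy_eq_sum:
  fixes F :: "'o \<Rightarrow> 'a::finite"
  shows "pmf_entropy q F = - (\<Sum>a\<in>UNIV. xlog2 (pmf (map_pmf F q) a))"
proof -
  have "measure_pmf.expectation q (\<lambda>w. log 2 (atom_prob q F w)) =
    measure_pmf.expectation (map_pmf F q) (\<lambda>a. log 2 (pmf (map_pmf F q) a))"
    by (simp add: atom_prob_eq_pmf)
  also have "\<dots> = (\<Sum>a\<in>UNIV. pmf (map_pmf F q) a * log 2 (pmf (map_pmf F q) a))"
    by (subst integral_measure_pmf[of UNIV]) auto
  also have "\<dots> = (\<Sum>a\<in>UNIV. xlog2 (pmf (map_pmf F q) a))"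
    by (intro sum.cong) (auto simp: xlog2_def not_less intro: order.antisym)
  finally show ?thesis by (simp add: pmf_entropy_def)
qed

lemma mutual_info_eq_table_info:
  fixes A :: "'o \<Rightarrow> 'a::finite" and B :: "'o \<Rightarrow> 'b::finite"
  assumes fin: "finite (set_pmf q)"
  shows "mutual_info q A B = table_info (map_pmf A q) (\<lambda>a b. pmf (map_pmf (\<lambda>w. (A w, B w)) q) (a, b))"
proof -
  let ?r = "\<lambda>a b. pmf (map_pmf (\<lambda>w. (A w, B w)) q) (a, b)"
  have rb: "(\<Sum>a\<in>UNIV. ?r a b) = pmf (map_pmf B q) b" for b
    using fin by (intro sum_pmf_map_pair) auto
  have ra: "(\<Sum>b\<in>UNIV. ?r a b) = pmf (map_pmf A q) a" for a
  proof -
    have "?r a b = pmf (map_pmf (\<lambda>w. (B w, A w)) q) (b, a)" for b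
      by (simp add: pmf_map vimage_def conj_commute)
    then show ?thesis using fin by (simp add: sum_pmf_map_pair)
  qed
  have "(\<Sum>a\<in>UNIV. pmf (map_pmf A q) a * log 2 (pmf (map_pmf A q) a)) = (\<Sum>a\<in>UNIV. xlog2 (pmf (map_pmf A q) a))"
    by (intro sum.cong) (auto simp: xlog2_def not_less intro: order.antisym)
  then show ?thesis
    unfolding mutual_info_eq_entropy[OF fin] pmf_entropy_eq_sum table_info_def ra rb
    by (simp add: sum.cartesian_product case_prod_unfold)
qed

lemma pmf_bind_Pair:
  "pmf (bind_pmf p (\<lambda>x. map_pmf (Pair x) (K x))) (a, b) = pmf p a * pmf (K a) b"
proof -
  have "pmf (map_pmf (Pair x) (K x)) (a, b) = of_bool (x \<in> {a}) * pmf (K a) b" for x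
    by (cases "x = a") (auto simp: pmf_map_inj' inj_def pmf_eq_0_set_pmf)
  then show ?thesis
    by (simp only: pmf_bind integral_mult_left_zero prob_eq_expectation[symmetric])
       (simp add: measure_pmf_single)
qed

lemma joint_pmf_eq: "joint_pmf p0 K = bind_pmf p0 (\<lambda>x. map_pmf (Pair x) (K x))"
  unfolding joint_pmf_def by (simp add: map_pmf_def case_prod_unfold)

lemma pmf_joint_pmf: "pmf (joint_pmf p0 K) (x, w) = pmf p0 x * pmf (K x) w"
  by (simp add: joint_pmf_eq pmf_bind_Pair)

lemma map_fst_joint_pmf: "map_pmf fst (joint_pmf p0 K) = p0"
  by (simp add: joint_pmf_eq map_bind_pmf pmf.map_comp o_def map_pmf_const bind_return_pmf')

text \<open>\<open>B\<close> selects the observed part of the output: \<open>fst\<close>,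
  \<open>snd\<close> and \<open>id\<close> give the three quantities of the outer region. The
  argument \<open>t\<close> is any real table, as continuity on the ambient space requires.\<close>

definition kernel_info ::
  "'x::finite pmf \<Rightarrow> ('w::finite \<Rightarrow> 'b::finite) \<Rightarrow> ('x \<Rightarrow> 'w \<Rightarrow> real) \<Rightarrow> real" where
  "kernel_info p B t = table_info p (\<lambda>a b. pmf p a * (\<Sum>w\<in>UNIV. of_bool (B w = b) * t a w))"

lemma mutual_info_joint_pmf:
  fixes p0 :: "'x::finite pmf" and K :: "'x \<Rightarrow> ('y::finite \<times> 'z::finite) pmf" and B :: "'y \<times> 'z \<Rightarrow> 'b::finite"
  assumes "\<And>w. D w = B (snd w)" "\<And>w. X w = fst w"
  shows "mutual_info (joint_pmf p0 K) X D = kernel_info p0 B (\<lambda>x. pmf (K x))"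
proof -
  have XD: "X = fst" "D = (\<lambda>w. B (snd w))" using assms by auto
  have "map_pmf (\<lambda>w. (fst w, B (snd w))) (joint_pmf p0 K) = bind_pmf p0 (\<lambda>x. map_pmf (Pair x) (map_pmf B (K x)))"
    by (simp add: joint_pmf_eq map_bind_pmf pmf.map_comp o_def)
  moreover have "pmf (map_pmf B (K a)) b = (\<Sum>w\<in>UNIV. of_bool (B w = b) * pmf (K a) w)" for a b
  proof -
    have "pmf (map_pmf B (K a)) b = measure_pmf.expectation (K a) (\<lambda>w. of_bool (B w = b))"
      by (simp add: pmf_map prob_eq_expectation)
    also have "\<dots> = (\<Sum>w\<in>UNIV. of_bool (B w = b) * pmf (K a) w)"
      by (subst integral_measure_pmf[of UNIV]) (auto simp: mult.commute)
    finally show ?thesis .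
  qed
  ultimately show ?thesis
    unfolding XD kernel_info_def by (simp add: mutual_info_eq_table_info map_fst_joint_pmf pmf_bind_Pair)
qed

lemma continuous_on_kernel_info: "continuous_on UNIV (kernel_info p B)"
  unfolding continuous_on_def kernel_info_def
proof (intro ballI tendsto_table_info tendsto_mult tendsto_sum tendsto_const)
  fix t :: "'a \<Rightarrow> 'b \<Rightarrow> real" and a w
  have "continuous_on UNIV (\<lambda>t :: 'a \<Rightarrow> 'b \<Rightarrow> real. t a w)"
    by (rule continuous_on_product_then_coordinatewise[OF continuous_on_product_coordinates])
  then show "((\<lambda>t. t a w) \<longlongrightarrow> t a w) (at t within UNIV)"
    by (auto simp: continuous_on_def)
qed

section \<open>From codes to rate inequalities\<close>

lemma finite_message_set: "finite (message_set R n)"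
  and card_message_set_le: "card (message_set R n) \<le> 2 powr (n * R)"
proof -
  have sub: "message_set R n \<subseteq> {1..nat \<lfloor>2 powr (n * R)\<rfloor>}"
    by (auto simp: message_set_def le_nat_floor)
  then show "finite (message_set R n)" by (rule finite_subset) simp
  have "card (message_set R n) \<le> nat \<lfloor>2 powr (n * R)\<rfloor>"
    using card_mono[OF _ sub] by simp
  also have "real (nat \<lfloor>2 powr (n * R)\<rfloor>) \<le> 2 powr (n * R)" by (simp add: of_nat_floor)
  finally show "card (message_set R n) \<le> 2 powr (n * R)" by simp
qed

lemma joint_type_bounds: "joint_type xs ys zs t \<ge> 0" "joint_type xs ys zs t \<le> 1"
proof -
  show "joint_type xs ys zs t \<ge> 0"
    unfolding joint_type_def by (intro mult_nonneg_nonneg sum_nonneg) auto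
  have "(\<Sum>k<length xs. of_bool ((xs ! k, ys ! k, zs ! k) = t)) \<le> (\<Sum>k<length xs. 1 :: real)"
    by (intro sum_mono) auto
  then show "joint_type xs ys zs t \<le> 1"
    unfolding joint_type_def by (cases "length xs = 0") (simp_all add: divide_le_eq_1)
qed

lemma abs_diff_le_tv_dist: "\<bar>p a - q a\<bar> \<le> 2 * tv_dist p q"
  unfolding tv_dist_def using member_le_sum[of a UNIV "\<lambda>a. \<bar>p a - q a\<bar>"] by simp

text \<open>Convergence in probability of bounded quantities forces convergence of the means: an
  entry is off by at most 1 on the bad event and by little elsewhere.\<close>

lemma expectation_joint_type_tendsto:
  fixes p0 :: "'x::finite pmf" and r :: "'x \<times> 'y::finite \<times> 'z::finite \<Rightarrow> real"
  assumes conv: "\<And>\<epsilon>. \<epsilon> > 0 \<Longrightarrow> (\<lambda>n. measure_pmf.prob (replicate_pmf n p0)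
      {xs. tv_dist (joint_type xs (ys n xs) (zs n xs)) r > \<epsilon>}) \<longlonglongrightarrow> 0"
    and r: "0 \<le> r t" "r t \<le> 1"
  shows "(\<lambda>n. measure_pmf.expectation (replicate_pmf n p0) (\<lambda>xs. joint_type xs (ys n xs) (zs n xs) t)) \<longlonglongrightarrow> r t"
proof (rule LIMSEQ_I)
  fix \<eta> :: real assume \<eta>: "\<eta> > 0"
  \<comment> \<open>Total variation carries a factor 1/2, so a distance of at most \<eta>/4 keeps
    each entry within \<eta>/2; the other \<eta>/2 pays for the bad event.\<close>
  define bad where "bad n = {xs. tv_dist (joint_type xs (ys n xs) (zs n xs)) r > \<eta> / 4}" for n
  obtain N where N: "\<And>n. n \<ge> N \<Longrightarrow> measure_pmf.prob (replicate_pmf n p0) (bad n) < \<eta> / 2"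
    using LIMSEQ_D[OF conv[of "\<eta> / 4"], of "\<eta> / 2"] \<eta> unfolding bad_def by auto
  show "\<exists>N. \<forall>n\<ge>N. norm (measure_pmf.expectation (replicate_pmf n p0) (\<lambda>xs. joint_type xs (ys n xs) (zs n xs) t) - r t) < \<eta>"
  proof (intro exI allI impI)
    fix n assume n: "n \<ge> N"
    let ?E = "measure_pmf.expectation (replicate_pmf n p0)"
    let ?j = "\<lambda>xs. joint_type xs (ys n xs) (zs n xs) t"
    have fin: "finite (set_pmf (replicate_pmf n p0))" by simp
    have "\<bar>?E ?j - r t\<bar> = \<bar>?E (\<lambda>xs. ?j xs - r t)\<bar>"
      using fin by (simp add: integrable_measure_pmf_finite)
    also have "\<dots> \<le> ?E (\<lambda>xs. \<bar>?j xs - r t\<bar>)" by (rule integral_abs_bound)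
    also have "\<dots> \<le> ?E (\<lambda>xs. \<eta> / 2 + of_bool (xs \<in> bad n))"
    proof (rule expectation_mono_finite[OF fin])
      fix xs
      have "\<bar>?j xs - r t\<bar> \<le> 1" using r joint_type_bounds[of xs "ys n xs" "zs n xs" t] by linarith
      moreover have "\<bar>?j xs - r t\<bar> \<le> 2 * tv_dist (joint_type xs (ys n xs) (zs n xs)) r"
        by (rule abs_diff_le_tv_dist)
      ultimately show "\<bar>?j xs - r t\<bar> \<le> \<eta> / 2 + of_bool (xs \<in> bad n)"
        using \<eta> by (auto simp: bad_def)
    qed
    also have "\<dots> = \<eta> / 2 + measure_pmf.prob (replicate_pmf n p0) (bad n)"
      using fin by (subst prob_eq_expectation) (simp add: integrable_measure_pmf_finite)
    also have "\<dots> < \<eta>" using N[OF n] by linarith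
    finally show "norm (?E ?j - r t) < \<eta>" by simp
  qed
qed

text \<open>One statement for all three rate bounds: \<open>e\<close> is the message or pair of
  messages, \<open>c\<close> the decoder, and \<open>B\<close> the part of the output that it
  determines.\<close>

lemma kernel_info_le_rate:
  fixes p0 :: "'x::finite pmf" and K :: "'x \<Rightarrow> ('y::finite \<times> 'z::finite) pmf" and B :: "'y \<times> 'z \<Rightarrow> 'b::finite"
    and e :: "nat \<Rightarrow> 'x list \<Rightarrow> 'm" and c :: "nat \<Rightarrow> 'm \<Rightarrow> nat \<Rightarrow> 'b"
    and S :: "nat \<Rightarrow> 'm set"
  assumes conv: "\<And>\<epsilon>. \<epsilon> > 0 \<Longrightarrow> (\<lambda>n. measure_pmf.prob (replicate_pmf n p0)
      {xs. tv_dist (joint_type xs (ys n xs) (zs n xs)) (pmf (joint_pmf p0 K)) > \<epsilon>}) \<longlonglongrightarrow> 0"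
    and S: "\<And>n. finite (S n)" "\<And>n. card (S n) \<le> 2 powr (n * R)"
    and e: "\<And>n xs. n \<ge> 1 \<Longrightarrow> length xs = n \<Longrightarrow> e n xs \<in> S n"
    and c: "\<And>n xs k. B (ys n xs ! k, zs n xs ! k) = c n (e n xs) k"
  shows "kernel_info p0 B (\<lambda>x. pmf (K x)) \<le> R"
proof -
  define m where "m n a w = measure_pmf.expectation (replicate_pmf n p0)
      (\<lambda>xs. joint_type xs (ys n xs) (zs n xs) (a, w))" for n a w
  have m_lim: "(\<lambda>n. m n a w) \<longlonglongrightarrow> pmf p0 a * pmf (K a) w" for a w
    unfolding m_def pmf_joint_pmf[symmetric] using conv by (rule expectation_joint_type_tendsto) (auto simp: pmf_le_1)
  \<comment> \<open>Merging outputs with equal \<open>B\<close> turns the expected joint type into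
    the mean table, which thus inherits its limit.\<close>
  have table: "mean_table p0 n (\<lambda>xs. c n (e n xs)) a b = (\<Sum>w\<in>UNIV. of_bool (B w = b) * m n a w)" for n a b
  proof -
    have "(\<Sum>w\<in>UNIV. of_bool (B w = b) * m n a w) = measure_pmf.expectation (replicate_pmf n p0)
      (\<lambda>xs. \<Sum>w\<in>UNIV. of_bool (B w = b) * joint_type xs (ys n xs) (zs n xs) (a, w))"
      unfolding m_def by (simp add: integrable_measure_pmf_finite Bochner_Integration.integral_sum)
    also have "\<dots> = mean_table p0 n (\<lambda>xs. c n (e n xs)) a b"
      unfolding mean_table_def
    proof (rule expectation_cong_finite)
      fix xs assume "xs \<in> set_pmf (replicate_pmf n p0)"
      then have len: "length xs = n" by (simp add: set_replicate_pmf)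
      let ?w = "\<lambda>k. (ys n xs ! k, zs n xs ! k)"
      have ind: "(\<Sum>w\<in>UNIV. of_bool (B w = b) * of_bool ((xs ! k, ?w k) = (a, w))) = (of_bool (xs ! k = a \<and> c n (e n xs) k = b) :: real)" for k
      proof -
        have "(\<Sum>w\<in>UNIV. of_bool (B w = b) * of_bool ((xs ! k, ?w k) = (a, w))) =
          (\<Sum>w\<in>UNIV. if ?w k = w then of_bool (xs ! k = a \<and> B w = b) else (0 :: real))"
          by (intro sum.cong) auto
        also have "\<dots> = of_bool (xs ! k = a \<and> B (?w k) = b)"
          by (subst sum.delta') simp_all
        finally show ?thesis by (simp add: c)
      qed
      have "(\<Sum>w\<in>UNIV. of_bool (B w = b) * joint_type xs (ys n xs) (zs n xs) (a, w)) =
        1 / n * (\<Sum>k<n. \<Sum>w\<in>UNIV. of_bool (B w = b) * of_bool ((xs ! k, ?w k) = (a, w)))"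
        unfolding joint_type_def len sum_distrib_left
        by (subst sum.swap, intro sum.cong refl) (simp only: ac_simps)
      also have "\<dots> = 1 / n * (\<Sum>k<n. of_bool (xs ! k = a \<and> c n (e n xs) k = b))"
        by (simp only: ind)
      finally show "(\<Sum>w\<in>UNIV. of_bool (B w = b) * joint_type xs (ys n xs) (zs n xs) (a, w)) =
        1 / n * (\<Sum>k<n. of_bool (xs ! k = a \<and> c n (e n xs) k = b))" .
    qed
    finally show ?thesis by simp
  qed
  have "(\<lambda>n. table_info p0 (mean_table p0 n (\<lambda>xs. c n (e n xs)))) \<longlonglongrightarrow>
      table_info p0 (\<lambda>a b. \<Sum>w\<in>UNIV. of_bool (B w = b) * (pmf p0 a * pmf (K a) w))"
    unfolding table by (intro tendsto_table_info tendsto_sum tendsto_mult tendsto_const m_lim)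
  moreover have "table_info p0 (mean_table p0 n (\<lambda>xs. c n (e n xs))) \<le> R" if n: "n \<ge> 1" for n
  proof -
    have "n * table_info p0 (mean_table p0 n (\<lambda>xs. c n (e n xs))) \<le> log 2 (card (S n))"
      using n S(1) e by (intro table_info_mean_table_le) auto
    also have "\<dots> \<le> log 2 (2 powr (n * R))"
      using S e[OF n, of "replicate n undefined"] by (subst log_le_cancel_iff) (auto simp: card_gt_0_iff)
    finally show ?thesis using n by simp
  qed
  ultimately have "table_info p0 (\<lambda>a b. \<Sum>w\<in>UNIV. of_bool (B w = b) * (pmf p0 a * pmf (K a) w)) \<le> R"
    by (intro LIMSEQ_le_const2) auto
  then show ?thesis
    unfolding kernel_info_def sum_distrib_left by (simp only: mult.left_commute)
qed

text \<open>The outer region is closed, so it contains the closure as soon as it contains the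
  achievable tuples.\<close>

lemma capacity_region_subset_outer_region:
  fixes p0 :: "'x::finite pmf"
  shows "(capacity_region p0 :: ('x, 'y::finite, 'z::finite) rate_tuple set) \<subseteq> outer_region p0"
proof -
  \<comment> \<open>Being the table of some kernel is not visibly a closed condition; nonnegativity
    with unit row sums is, and \<open>embed_pmf\<close> recovers the kernel.\<close>
  define kernels :: "('x \<Rightarrow> 'y \<times> 'z \<Rightarrow> real) set"
    where "kernels = {t. (\<forall>x w. 0 \<le> t x w) \<and> (\<forall>x. (\<Sum>w\<in>UNIV. t x w) = 1)}"
  have kernels: "t \<in> kernels \<longleftrightarrow> (\<exists>K. t = (\<lambda>x. pmf (K x)))" for t
  proof
    assume t: "t \<in> kernels"
    have "pmf (embed_pmf (t x)) = t x" for x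
    proof (intro ext pmf_embed_pmf)
      have "(\<Sum>w\<in>UNIV. ennreal (t x w)) = ennreal (\<Sum>w\<in>UNIV. t x w)"
        using t unfolding kernels_def by (intro sum_ennreal) blast
      then show "(\<integral>\<^sup>+ w. ennreal (t x w) \<partial>count_space UNIV) = 1"
        using t by (simp add: kernels_def nn_integral_count_space_finite)
    qed (use t in \<open>auto simp: kernels_def\<close>)
    then show "\<exists>K. t = (\<lambda>x. pmf (K x))" by (intro exI[of _ "\<lambda>x. embed_pmf (t x)"]) simp
  qed (auto simp: kernels_def sum_pmf_eq_1)
  let ?I1 = "kernel_info p0 (fst :: 'y \<times> 'z \<Rightarrow> 'y)" and ?I2 = "kernel_info p0 (snd :: 'y \<times> 'z \<Rightarrow> 'z)"
    and ?I12 = "kernel_info p0 (id :: 'y \<times> 'z \<Rightarrow> 'y \<times> 'z)"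
  have outer: "outer_region p0 = {(R1, R2, t). R1 \<ge> 0 \<and> R2 \<ge> 0 \<and> t \<in> kernels \<and>
    R1 \<ge> ?I1 t \<and> R2 \<ge> ?I2 t \<and> R1 + R2 \<ge> ?I12 t}"
  proof -
    have "mutual_info (joint_pmf p0 K) (\<lambda>(x, y, z). x) (\<lambda>(x, y, z). y) = ?I1 (\<lambda>x. pmf (K x))"
      "mutual_info (joint_pmf p0 K) (\<lambda>(x, y, z). x) (\<lambda>(x, y, z). z) = ?I2 (\<lambda>x. pmf (K x))"
      "mutual_info (joint_pmf p0 K) (\<lambda>(x, y, z). x)
        (\<lambda>w. ((\<lambda>(x, y, z). y) w, (\<lambda>(x, y, z). z) w)) = ?I12 (\<lambda>x. pmf (K x))"
      for K :: "'x \<Rightarrow> ('y \<times> 'z) pmf"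
      by (rule mutual_info_joint_pmf; simp add: case_prod_unfold)+
    then show ?thesis
      unfolding outer_region_def Let_def rate_tuple_def kernels by auto
  qed
  have eval: "continuous_on UNIV (\<lambda>v :: ('x, 'y, 'z) rate_tuple. snd (snd v) x w)" for x w
    by (rule continuous_on_product_then_coordinatewise, rule continuous_on_product_then_coordinatewise)
       (intro continuous_on_snd continuous_on_id)
  have info: "continuous_on UNIV (\<lambda>v :: ('x, 'y, 'z) rate_tuple. kernel_info p0 B (snd (snd v)))"
    for B :: "'y \<times> 'z \<Rightarrow> 'b::finite"
  proof (rule continuous_on_compose2[OF continuous_on_kernel_info])
    show "continuous_on UNIV (\<lambda>v :: ('x, 'y, 'z) rate_tuple. snd (snd v))"
      by (intro continuous_on_snd continuous_on_id)
  qed simp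
  have "closed (outer_region p0 :: ('x, 'y, 'z) rate_tuple set)"
    unfolding outer kernels_def case_prod_unfold mem_Collect_eq
    by (intro closed_Collect_conj closed_Collect_all closed_Collect_le closed_Collect_eq
        continuous_on_const continuous_on_add continuous_on_sum continuous_on_fst continuous_on_snd continuous_on_id eval info)
  moreover have "rate_tuple R1 R2 K \<in> outer_region p0"
    if "R1 \<ge> 0" "R2 \<ge> 0" and ach: "achievable p0 K R1 R2" for R1 R2 and K :: "'x \<Rightarrow> ('y \<times> 'z) pmf"
  proof -
    obtain i j yd zd where code: "\<And>n. n \<ge> 1 \<Longrightarrow> coordination_code R1 R2 n (i n) (j n) (yd n) (zd n)"
      and conv: "\<And>\<epsilon>. \<epsilon> > 0 \<Longrightarrow> (\<lambda>n. measure_pmf.prob (replicate_pmf n p0)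
            {xs. tv_dist (joint_type xs (yd n (i n xs)) (zd n (j n xs))) (pmf (joint_pmf p0 K)) > \<epsilon>}) \<longlonglongrightarrow> 0"
      using ach unfolding achievable_def by blast
    have ij: "i n xs \<in> message_set R1 n" "j n xs \<in> message_set R2 n" if "n \<ge> 1" "length xs = n" for n xs
      using code[OF that(1)] that(2) unfolding coordination_code_def by auto
    have "?I1 (\<lambda>x. pmf (K x)) \<le> R1"
      by (rule kernel_info_le_rate[OF conv finite_message_set card_message_set_le ij(1), where c = "\<lambda>n m k. yd n m ! k"]) auto
    moreover have "?I2 (\<lambda>x. pmf (K x)) \<le> R2"
      by (rule kernel_info_le_rate[OF conv finite_message_set card_message_set_le ij(2), where c = "\<lambda>n m k. zd n m ! k"]) auto
    \<comment> \<open>For the sum rate the two decoders act as one that receives both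
      messages.\<close>
    moreover have "?I12 (\<lambda>x. pmf (K x)) \<le> R1 + R2"
    proof (rule kernel_info_le_rate[OF conv, where e = "\<lambda>n xs. (i n xs, j n xs)"
          and S = "\<lambda>n. message_set R1 n \<times> message_set R2 n" and c = "\<lambda>n m k. (yd n (fst m) ! k, zd n (snd m) ! k)"])
      show "card (message_set R1 n \<times> message_set R2 n) \<le> 2 powr (n * (R1 + R2))" for n
        using mult_mono[OF card_message_set_le[of R1 n] card_message_set_le[of R2 n]]
        by (simp add: card_cartesian_product distrib_left powr_add)
    qed (use ij finite_message_set in auto)
    ultimately show ?thesis
      using that unfolding outer rate_tuple_def kernels by auto
  qed
  ultimately show ?thesis
    unfolding capacity_region_def by (intro closure_minimal) auto
qed

section \<open>Inner bound\<close>

text \<open>A union bound over the finitely many test functions.\<close>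

lemma weak_law_simultaneous:
  fixes H :: "('a \<Rightarrow> real) set" and \<delta> :: real
  assumes fin: "finite (set_pmf p)" "finite H" and "\<delta> > 0"
  shows "(\<lambda>n. measure_pmf.prob (replicate_pmf n p)
    {xs. \<forall>h\<in>H. \<bar>(\<Sum>x\<leftarrow>xs. h x) - n * measure_pmf.expectation p h\<bar> < n * \<delta>}) \<longlonglongrightarrow> 1"
proof -
  define bad where "bad n h = {xs. \<bar>(\<Sum>x\<leftarrow>xs. h x) - n * measure_pmf.expectation p h\<bar> \<ge> n * \<delta>}" for n :: nat and h
  have bound: "1 - (\<Sum>h\<in>H. measure_pmf.prob (replicate_pmf n p) (bad n h)) \<le> measure_pmf.prob (replicate_pmf n p)
    {xs. \<forall>h\<in>H. \<bar>(\<Sum>x\<leftarrow>xs. h x) - n * measure_pmf.expectation p h\<bar> < n * \<delta>}" for n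
  proof -
    have "{xs. \<forall>h\<in>H. \<bar>(\<Sum>x\<leftarrow>xs. h x) - n * measure_pmf.expectation p h\<bar> < n * \<delta>} = UNIV - (\<Union>h\<in>H. bad n h)"
      by (auto simp: bad_def not_le)
    moreover have "measure_pmf.prob (replicate_pmf n p) (UNIV - (\<Union>h\<in>H. bad n h)) =
        1 - measure_pmf.prob (replicate_pmf n p) (\<Union>h\<in>H. bad n h)"
      using measure_pmf.prob_compl[of "\<Union>h\<in>H. bad n h" "replicate_pmf n p"] by simp
    moreover have "measure_pmf.prob (replicate_pmf n p) (\<Union>h\<in>H. bad n h) \<le>
        (\<Sum>h\<in>H. measure_pmf.prob (replicate_pmf n p) (bad n h))"
      using fin by (intro measure_pmf.finite_measure_subadditive_finite) auto
    ultimately show ?thesis by simp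
  qed
  have "(\<lambda>n. 1 - (\<Sum>h\<in>H. measure_pmf.prob (replicate_pmf n p) (bad n h))) \<longlonglongrightarrow> 1 - (\<Sum>h\<in>H. 0)"
    unfolding bad_def using assms by (intro tendsto_diff tendsto_sum tendsto_const weak_law_replicate_pmf)
  then have lower: "(\<lambda>n. 1 - (\<Sum>h\<in>H. measure_pmf.prob (replicate_pmf n p) (bad n h))) \<longlonglongrightarrow> 1" by simp
  show ?thesis
    by (rule tendsto_sandwich[OF _ _ lower tendsto_const]) (use bound in auto)
qed

section \<open>Block likelihoods and assembly of codes\<close>

lemma map_pair_eq_iff:
  "map (\<lambda>w. (F w, G w)) vs = map (\<lambda>w. (F w, G w)) ws \<longleftrightarrow> map F vs = map F ws \<and> map G vs = map G ws"
  by (induction vs ws rule: list_induct2') auto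

text \<open>The block probability is a product of positive letter probabilities. Bounds on block
  likelihood ratios thus become bounds on sums of per-letter logarithms.\<close>

lemma atom_prob_replicate:
  assumes "ws \<in> set_pmf (replicate_pmf n q)"
  shows "atom_prob (replicate_pmf n q) (map F) ws = 2 powr (\<Sum>w\<leftarrow>ws. log 2 (atom_prob q F w))"
proof -
  have ws: "length ws = n" "set ws \<subseteq> set_pmf q" using assms by (auto simp: set_replicate_pmf)
  have "atom_prob (replicate_pmf n q) (map F) ws = prod_list (map (atom_prob q F) ws)"
    using ws by (simp add: atom_prob_eq_pmf[abs_def] map_replicate_pmf pmf_replicate_pmf o_def)
  also have "\<dots> = 2 powr (\<Sum>w\<leftarrow>ws. log 2 (atom_prob q F w))"
    using ws(2) by (induction ws) (auto simp: powr_add atom_prob_pos)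
  finally show ?thesis .
qed

lemma atom_prob_replicate_cong:
  assumes "ws \<in> set_pmf (replicate_pmf n q)" "\<And>v w. F' v = F' w \<longleftrightarrow> map F v = map F w"
  shows "atom_prob (replicate_pmf n q) F' ws = 2 powr (\<Sum>w\<leftarrow>ws. log 2 (atom_prob q F w))"
  using atom_prob_replicate[OF assms(1), of F] atom_prob_cong[of F' "map F"] assms(2) by metis

lemma joint_type_map:
  "joint_type (map X ws) (map Y ws) (map Z ws) t = 1 / length ws * (\<Sum>w\<leftarrow>ws. of_bool ((X w, Y w, Z w) = t))"
  by (simp add: joint_type_def sum_list_sum_nth atLeast0LessThan)

text \<open>Both encoders compute the same triple \<open>choice x\<close>, and each sends the
  cluster index together with its own private index.\<close>

lemma code_of_covering:
  fixes y :: "nat \<Rightarrow> nat \<Rightarrow> 'y list" and z :: "nat \<Rightarrow> nat \<Rightarrow> 'z list" and D :: "'x list \<Rightarrow> 'y list \<Rightarrow> 'z list \<Rightarrow> bool"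
  assumes pos: "M0 > 0" "M1 > 0" "M2 > 0"
    and M: "real (M0 * M1) \<le> 2 powr (n * R1)" "real (M0 * M2) \<le> 2 powr (n * R2)"
    and len: "\<And>x y z. D x y z \<Longrightarrow> length y = n \<and> length z = n"
  shows "\<exists>i j yd zd. coordination_code R1 R2 n i j yd zd \<and>
    (\<forall>x. (\<exists>k<M0. \<exists>a<M1. \<exists>b<M2. D x (y k a) (z k b)) \<longrightarrow> D x (yd (i x)) (zd (j x)))"
proof -
  define good where "good x = (\<lambda>(k, a, b). k < M0 \<and> a < M1 \<and> b < M2 \<and> D x (y k a) (z k b))" for x
  define choice where "choice x = (if Ex (good x) then Eps (good x) else (0, 0, 0))" for x
  \<comment> \<open>Mixed radix with digits \<open>k\<close> and \<open>a\<close>, undone by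
    \<open>div\<close> and \<open>mod\<close>; the shift by 1 is there because messages start at
    1.\<close>
  define i where "i x = (case choice x of (k, a, b) \<Rightarrow> 1 + (k * M1 + a))" for x
  define j where "j x = (case choice x of (k, a, b) \<Rightarrow> 1 + (k * M2 + b))" for x
  \<comment> \<open>A code needs words of length \<open>n\<close> for every message; by the
    assumption on \<open>D\<close>, a matching word already has that length and is kept.\<close>
  define yd where "yd m = (let v = y ((m - 1) div M1) ((m - 1) mod M1) in if length v = n then v else replicate n undefined)" for m
  define zd where "zd m = (let v = z ((m - 1) div M2) ((m - 1) mod M2) in if length v = n then v else replicate n undefined)" for m
  have choice: "fst (choice x) < M0 \<and> fst (snd (choice x)) < M1 \<and> snd (snd (choice x)) < M2" for x
    using pos someI_ex[of "good x"] by (auto simp: choice_def good_def case_prod_unfold)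
  have index: "1 + (k * L + a) \<le> M0 * L" if "k < M0" "a < L" for k a L :: nat
  proof -
    have "1 + (k * L + a) \<le> Suc k * L" using that by simp
    also have "\<dots> \<le> M0 * L" using that by (intro mult_right_mono) auto
    finally show ?thesis .
  qed
  have "i x \<in> message_set R1 n" for x
    using index[of "fst (choice x)" "fst (snd (choice x))" M1] choice[of x] M(1)
    unfolding message_set_def i_def by (auto simp: case_prod_unfold simp flip: of_nat_mult intro: order.trans[OF of_nat_mono])
  moreover have "j x \<in> message_set R2 n" for x
    using index[of "fst (choice x)" "snd (snd (choice x))" M2] choice[of x] M(2)
    unfolding message_set_def j_def by (auto simp: case_prod_unfold simp flip: of_nat_mult intro: order.trans[OF of_nat_mono])
  ultimately have "coordination_code R1 R2 n i j yd zd"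
    by (auto simp: coordination_code_def yd_def zd_def Let_def)
  moreover have "D x (yd (i x)) (zd (j x))" if ex: "\<exists>k<M0. \<exists>a<M1. \<exists>b<M2. D x (y k a) (z k b)" for x
  proof -
    obtain k a b where c: "choice x = (k, a, b)" by (cases "choice x")
    have "Ex (good x)" using ex by (auto simp: good_def)
    then have "good x (k, a, b)" using c someI_ex[of "good x"] by (simp add: choice_def)
    then have D: "k < M0" "a < M1" "b < M2" "D x (y k a) (z k b)" by (auto simp: good_def)
    then show ?thesis using len[OF D(4)] by (simp add: i_def j_def c yd_def zd_def)
  qed
  ultimately show ?thesis by blast
qed

text \<open>For each \<open>n\<close>, take an object for the smallest tolerance of the form 1 / (k
  + 1) with k \<le> n that is available. The restriction k \<le> n makes the maximal k exist, and
  tolerance 1 is always available.\<close>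

lemma diagonal_choice:
  fixes Q :: "nat \<Rightarrow> real \<Rightarrow> 'c \<Rightarrow> bool"
  assumes mono: "\<And>n e e' c. Q n e c \<Longrightarrow> e \<le> e' \<Longrightarrow> Q n e' c"
    and ex: "\<And>e. e > 0 \<Longrightarrow> \<exists>N. \<forall>n\<ge>N. \<exists>c. Q n e c"
    and ex1: "\<And>n. \<exists>c. Q n 1 c"
  shows "\<exists>c. (\<forall>n. Q n 1 (c n)) \<and> (\<forall>e>0. \<exists>N. \<forall>n\<ge>N. Q n e (c n))"
proof -
  define A where "A n = {k. k \<le> n \<and> (\<exists>c. Q n (1 / (real k + 1)) c)}" for n :: nat
  have A: "finite (A n)" "0 \<in> A n" for n
    using ex1 finite_subset[of "A n" "{..n}"] by (auto simp: A_def)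
  have "\<forall>n. \<exists>c. Q n (1 / (real (Max (A n)) + 1)) c"
  proof
    fix n
    have "Max (A n) \<in> A n" using A[of n] by (intro Max_in) auto
    then show "\<exists>c. Q n (1 / (real (Max (A n)) + 1)) c" by (subst (asm) (2) A_def) simp
  qed
  from choice[OF this] obtain c where c: "\<And>n. Q n (1 / (real (Max (A n)) + 1)) (c n)" by blast
  have "\<exists>N. \<forall>n\<ge>N. Q n e (c n)" if e: "e > 0" for e
  proof -
    obtain k where k: "1 / (real k + 1) < e"
      using reals_Archimedean[OF e] by (auto simp: inverse_eq_divide add.commute)
    obtain N where N: "\<And>n. n \<ge> N \<Longrightarrow> \<exists>c. Q n (1 / (real k + 1)) c"
      using ex[of "1 / (real k + 1)"] by auto
    have "Q n e (c n)" if "n \<ge> max N k" for n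
    proof (rule mono[OF c])
      have "k \<in> A n" using N[of n] that by (auto simp: A_def)
      then have "k \<le> Max (A n)" using A by simp
      then have "1 / (real (Max (A n)) + 1) \<le> 1 / (real k + 1)" by (intro divide_left_mono) auto
      then show "1 / (real (Max (A n)) + 1) \<le> e" using k by linarith
    qed
    then show ?thesis by blast
  qed
  moreover have "Q n 1 (c n)" for n by (rule mono[OF c]) simp
  ultimately show ?thesis by blast
qed

text \<open>Rounding a codebook size up costs at most a factor 2.\<close>

lemma nat_ceiling_bounds:
  fixes t :: real
  assumes "t \<ge> 1"
  shows "t \<le> real (nat \<lceil>t\<rceil>)" "real (nat \<lceil>t\<rceil>) \<le> 2 * t" "nat \<lceil>t\<rceil> > 0"
  using assms by linarith+

text \<open>The codebook has about \<open>2 powr (n * I0)\<close> clusters, and each cluster uses up the remaining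
  rate of either message; \<open>\<delta>\<close> is the unit of slack.\<close>

lemma covering_codes_exist:
  fixes q :: "'o pmf" and X :: "'o \<Rightarrow> 'x::finite" and U :: "'o \<Rightarrow> 'u"
    and Y :: "'o \<Rightarrow> 'y::finite" and Z :: "'o \<Rightarrow> 'z::finite"
  assumes fin: "finite (set_pmf q)"
    and I0: "I0 = pmf_entropy q X + pmf_entropy q U - pmf_entropy q (\<lambda>w. (X w, U w))"
    and I1: "I1 = pmf_entropy q X + pmf_entropy q (\<lambda>w. (U w, Y w)) - pmf_entropy q (\<lambda>w. (X w, U w, Y w))"
    and I2: "I2 = pmf_entropy q X + pmf_entropy q (\<lambda>w. (U w, Z w)) - pmf_entropy q (\<lambda>w. (X w, U w, Z w))"
    and I3: "I3 = pmf_entropy q X + pmf_entropy q (\<lambda>w. (U w, Y w)) + pmf_entropy q (\<lambda>w. (U w, Z w))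
      - pmf_entropy q U - pmf_entropy q (\<lambda>w. (X w, U w, Y w, Z w))"
    and I_le: "0 \<le> I0" "I0 \<le> I1" "I0 \<le> I2"
    and R: "R1 \<ge> I1" "R2 \<ge> I2" "R1 + R2 \<ge> I0 + I3"
    and \<delta>: "\<delta> > 0" and \<epsilon>: "\<epsilon> > 0"
  shows "\<exists>N. \<forall>n\<ge>N. \<exists>i j yd zd. coordination_code (R1 + 6 * \<delta>) (R2 + 6 * \<delta>) n i j yd zd \<and>
    measure_pmf.prob (replicate_pmf n (map_pmf X q))
      {xs. tv_dist (joint_type xs (yd (i xs)) (zd (j xs))) (pmf (map_pmf (\<lambda>w. (X w, Y w, Z w)) q)) > \<epsilon>} \<le> \<epsilon>"
proof -
  let ?XYZ = "\<lambda>w. (X w, Y w, Z w)"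
  \<comment> \<open>\<open>i0\<close> to \<open>i3\<close> are the per-letter logarithms of the
    ratios bounded by \<open>A0\<close> to \<open>A3\<close> in \<open>mutual_covering\<close>. The
    mean of \<open>i3\<close> is I(X;U,Y,Z) + I(Y;Z|U).\<close>
  define i0 where "i0 w = log 2 (atom_prob q (\<lambda>w. (X w, U w)) w) - log 2 (atom_prob q X w) - log 2 (atom_prob q U w)" for w
  define i1 where "i1 w = log 2 (atom_prob q (\<lambda>w. (X w, U w, Y w)) w) - log 2 (atom_prob q X w)
    - log 2 (atom_prob q (\<lambda>w. (U w, Y w)) w)" for w
  define i2 where "i2 w = log 2 (atom_prob q (\<lambda>w. (X w, U w, Z w)) w) - log 2 (atom_prob q X w)
    - log 2 (atom_prob q (\<lambda>w. (U w, Z w)) w)" for w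
  define i3 where "i3 w = log 2 (atom_prob q (\<lambda>w. (X w, U w, Y w, Z w)) w) + log 2 (atom_prob q U w) - log 2 (atom_prob q X w)
    - log 2 (atom_prob q (\<lambda>w. (U w, Y w)) w) - log 2 (atom_prob q (\<lambda>w. (U w, Z w)) w)" for w
  have means: "measure_pmf.expectation q i0 = I0" "measure_pmf.expectation q i1 = I1"
    "measure_pmf.expectation q i2 = I2" "measure_pmf.expectation q i3 = I3"
    unfolding i0_def[abs_def] i1_def[abs_def] i2_def[abs_def] i3_def[abs_def] I0 I1 I2 I3 pmf_entropy_def
    using fin by (simp_all add: integrable_measure_pmf_finite)
  \<comment> \<open>The densities control the likelihood ratios, the indicators control the joint
    type.\<close>
  define H where "H = {i0, i1, i2, i3} \<union> range (\<lambda>t w. of_bool (?XYZ w = t))"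
  have in_H: "i0 \<in> H" "i1 \<in> H" "i2 \<in> H" "i3 \<in> H" by (auto simp: H_def)
  define c where "c = real (card (UNIV :: ('x \<times> 'y \<times> 'z) set))"
  have c: "c > 0" by (simp add: c_def card_gt_0_iff)
  \<comment> \<open>The bound \<delta> serves the densities; \<open>\<epsilon> / c\<close> keeps the
    sum of the \<open>c\<close> entrywise deviations below \<epsilon>.\<close>
  define \<eta> where "\<eta> = min \<delta> (\<epsilon> / c)"
  have \<eta>: "\<eta> > 0" "\<eta> \<le> \<delta>" "c * \<eta> \<le> \<epsilon>"
    using c \<delta> \<epsilon> by (auto simp: \<eta>_def min_def field_simps)
  define T where "T n = {ws \<in> set_pmf (replicate_pmf n q).
    \<forall>h\<in>H. \<bar>(\<Sum>w\<leftarrow>ws. h w) - n * measure_pmf.expectation q h\<bar> < n * \<eta>}" for n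
  have T_lim: "(\<lambda>n. measure_pmf.prob (replicate_pmf n q) (T n)) \<longlonglongrightarrow> 1"
  proof -
    have "measure_pmf.prob (replicate_pmf n q) (T n) = measure_pmf.prob (replicate_pmf n q)
      {ws. \<forall>h\<in>H. \<bar>(\<Sum>w\<leftarrow>ws. h w) - n * measure_pmf.expectation q h\<bar> < n * \<eta>}" for n
      unfolding T_def by (intro measure_pmf.finite_measure_eq_AE) (auto simp: AE_measure_pmf_iff)
    then show ?thesis
      using weak_law_simultaneous[OF fin _ \<eta>(1), of H] by (simp add: H_def)
  qed
  define s where "s n = 2 powr (- (n * \<delta>))" for n :: nat
  have s_lim: "s \<longlonglongrightarrow> 0"
  proof -
    have "s = (\<lambda>n. (2 powr - \<delta>) ^ n)"
      by (intro ext) (simp add: s_def powr_realpow[symmetric] powr_powr mult.commute)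
    moreover have "2 powr - \<delta> < 1" using \<delta> by (simp add: powr_less_one)
    ultimately show ?thesis by (simp add: LIMSEQ_power_zero)
  qed
  \<comment> \<open>Each of the four covering terms will be at most \<open>s n * M0\<close>; the
    factor 2 in \<open>mutual_covering\<close> makes this 8.\<close>
  have "(\<lambda>n. 8 * s n + 2 * (1 - measure_pmf.prob (replicate_pmf n q) (T n))) \<longlonglongrightarrow> 8 * 0 + 2 * (1 - 1)"
    by (intro tendsto_intros s_lim T_lim)
  then have "eventually (\<lambda>n. 8 * s n + 2 * (1 - measure_pmf.prob (replicate_pmf n q) (T n)) < \<epsilon>) sequentially"
    using \<epsilon> by (intro order_tendstoD) auto
  \<comment> \<open>Rounding up two codebook sizes costs a factor 4, which is then at most
    \<open>2 powr (n * \<delta>)\<close>.\<close>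
  moreover have "eventually (\<lambda>n. n * \<delta> \<ge> 2) sequentially"
  proof -
    obtain N :: nat where "N \<ge> 2 / \<delta>" using real_arch_simple by blast
    then show ?thesis
      using \<delta> by (intro eventually_sequentiallyI[of N]) (auto simp: field_simps intro: order.trans mult_left_mono)
  qed
  ultimately have "eventually (\<lambda>n. \<exists>i j yd zd. coordination_code (R1 + 6 * \<delta>) (R2 + 6 * \<delta>) n i j yd zd \<and>
    measure_pmf.prob (replicate_pmf n (map_pmf X q))
      {xs. tv_dist (joint_type xs (yd (i xs)) (zd (j xs))) (pmf (map_pmf ?XYZ q)) > \<epsilon>} \<le> \<epsilon>) sequentially"
  proof eventually_elim
    case (elim n)
    then have n: "n > 0" by (cases n) auto
    let ?Q = "replicate_pmf n q"
    \<comment> \<open>Typicality costs one \<delta>, so \<open>2 * \<delta>\<close> in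
      \<open>m0\<close> leaves the gain \<open>s n\<close>. The products \<open>m0 * m1\<close> and
      \<open>m0 * m2\<close> have exponents R1 + 5\<delta> and R2 + 5\<delta> per letter, and the
      sixth \<delta> pays for rounding.\<close>
    define m0 m1 m2 where "m0 = 2 powr (n * (I0 + 2 * \<delta>))" and "m1 = 2 powr (n * (R1 - I0 + 3 * \<delta>))"
      and "m2 = 2 powr (n * (R2 - I0 + 3 * \<delta>))"
    define M0 M1 M2 where "M0 = nat \<lceil>m0\<rceil>" and "M1 = nat \<lceil>m1\<rceil>" and "M2 = nat \<lceil>m2\<rceil>"
    have "m0 \<ge> 1" "m1 \<ge> 1" "m2 \<ge> 1"
      unfolding m0_def m1_def m2_def using I_le R \<delta> by (auto intro!: ge_one_powr_ge_zero mult_nonneg_nonneg)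
    note M0 = nat_ceiling_bounds[OF this(1), folded M0_def] and M1 = nat_ceiling_bounds[OF this(2), folded M1_def]
      and M2 = nat_ceiling_bounds[OF this(3), folded M2_def]
    have T_dev: "\<bar>(\<Sum>w\<leftarrow>ws. h w) - n * measure_pmf.expectation q h\<bar> < n * \<eta>" if "ws \<in> T n" "h \<in> H" for ws h
      using that by (auto simp: T_def)
    have dens: "(\<Sum>w\<leftarrow>ws. h w) \<le> n * (measure_pmf.expectation q h + \<delta>)" if "ws \<in> T n" "h \<in> H" for ws h
    proof -
      have "n * \<eta> \<le> n * \<delta>" using \<eta>(2) by (intro mult_left_mono) auto
      then show ?thesis using T_dev[OF that] by (simp add: distrib_left)
    qed
    have Tn: "ws \<in> set_pmf ?Q" if "ws \<in> T n" for ws using that by (simp add: T_def)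
    have "\<exists>y z. measure_pmf.prob (map_pmf (map X) ?Q)
      {x. \<not> (\<exists>k<M0. \<exists>a<M1. \<exists>b<M2. \<exists>w\<in>T n. map X w = x \<and> map Y w = y k a \<and> map Z w = z k b)}
    \<le> 2 * (2 powr (n * (I0 + \<delta>)) + 2 powr (n * (I1 + \<delta>)) / M1 + 2 powr (n * (I2 + \<delta>)) / M2
        + 2 powr (n * (I3 + \<delta>)) / (M1 * M2)) / M0 + 2 * (1 - measure_pmf.prob ?Q (T n))"
    proof (rule mutual_covering[where U = "map U"])
      fix ws assume ws: "ws \<in> T n"
      note ap = atom_prob_replicate_cong[OF Tn[OF ws]] atom_prob_replicate[OF Tn[OF ws]]
      show "atom_prob ?Q (\<lambda>w. (map X w, map U w)) ws \<le> 2 powr (n * (I0 + \<delta>)) * (atom_prob ?Q (map X) ws * atom_prob ?Q (map U) ws)"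
        using dens[OF ws in_H(1)] unfolding means i0_def sum_list_subtractf
        by (simp add: ap(1)[of _ "\<lambda>w. (X w, U w)"] ap(2) map_pair_eq_iff powr_add[symmetric])
      show "atom_prob ?Q (\<lambda>w. (map X w, map U w, map Y w)) ws \<le> 2 powr (n * (I1 + \<delta>)) *
        (atom_prob ?Q (map X) ws * atom_prob ?Q (\<lambda>w. (map U w, map Y w)) ws)"
        using dens[OF ws in_H(2)] unfolding means i1_def sum_list_subtractf
        by (simp add: ap(1)[of _ "\<lambda>w. (X w, U w, Y w)"] ap(1)[of _ "\<lambda>w. (U w, Y w)"] ap(2) map_pair_eq_iff powr_add[symmetric])
      show "atom_prob ?Q (\<lambda>w. (map X w, map U w, map Z w)) ws \<le> 2 powr (n * (I2 + \<delta>)) *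
        (atom_prob ?Q (map X) ws * atom_prob ?Q (\<lambda>w. (map U w, map Z w)) ws)"
        using dens[OF ws in_H(3)] unfolding means i2_def sum_list_subtractf
        by (simp add: ap(1)[of _ "\<lambda>w. (X w, U w, Z w)"] ap(1)[of _ "\<lambda>w. (U w, Z w)"] ap(2) map_pair_eq_iff powr_add[symmetric])
      show "atom_prob ?Q (\<lambda>w. (map X w, map U w, map Y w, map Z w)) ws * atom_prob ?Q (map U) ws \<le> 2 powr (n * (I3 + \<delta>)) *
        (atom_prob ?Q (map X) ws * atom_prob ?Q (\<lambda>w. (map U w, map Y w)) ws * atom_prob ?Q (\<lambda>w. (map U w, map Z w)) ws)"
        using dens[OF ws in_H(4)] unfolding means i3_def sum_list_subtractf sum_list_addf
        by (simp add: ap(1)[of _ "\<lambda>w. (X w, U w, Y w, Z w)"] ap(1)[of _ "\<lambda>w. (U w, Y w)"]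
          ap(1)[of _ "\<lambda>w. (U w, Z w)"] ap(2) map_pair_eq_iff powr_add[symmetric])
    qed (use fin M0 M1 M2 Tn in auto)
    then obtain y z where fail: "measure_pmf.prob (map_pmf (map X) ?Q)
      {x. \<not> (\<exists>k<M0. \<exists>a<M1. \<exists>b<M2. \<exists>w\<in>T n. map X w = x \<and> map Y w = y k a \<and> map Z w = z k b)}
    \<le> 2 * (2 powr (n * (I0 + \<delta>)) + 2 powr (n * (I1 + \<delta>)) / M1 + 2 powr (n * (I2 + \<delta>)) / M2
        + 2 powr (n * (I3 + \<delta>)) / (M1 * M2)) / M0 + 2 * (1 - measure_pmf.prob ?Q (T n))" by blast
    have "2 powr (n * (I0 + \<delta>)) \<le> s n * M0"
    proof -
      have "2 powr (n * (I0 + \<delta>)) = s n * m0"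
        by (simp add: s_def m0_def powr_add[symmetric] algebra_simps)
      also have "\<dots> \<le> s n * M0" using M0 by (intro mult_left_mono) (auto simp: s_def)
      finally show ?thesis .
    qed
    moreover have cluster_rate: "2 powr (n * (I + \<delta>)) / L \<le> s n * M0"
      if "I \<le> R" "2 powr (n * (R - I0 + 3 * \<delta>)) \<le> real L" "L > 0" for I R and L :: nat
    proof -
      have "n * (I + \<delta>) \<le> n * (R + 4 * \<delta>)" using that \<delta> by (intro mult_left_mono) auto
      then have "2 powr (n * (I + \<delta>)) \<le> 2 powr (n * (R + 4 * \<delta>))" by simp
      also have "\<dots> = s n * (m0 * 2 powr (n * (R - I0 + 3 * \<delta>)))"
        by (simp add: s_def m0_def powr_add[symmetric] algebra_simps)
      also have "\<dots> \<le> s n * (M0 * L)"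
        unfolding of_nat_mult using M0 that(2) by (intro mult_left_mono mult_mono) (auto simp: s_def)
      finally show ?thesis using that(3) by (simp add: divide_le_eq mult.assoc)
    qed
    then have "2 powr (n * (I1 + \<delta>)) / M1 \<le> s n * M0" "2 powr (n * (I2 + \<delta>)) / M2 \<le> s n * M0"
      using M1 M2 R by (auto simp: m1_def m2_def intro: cluster_rate[of I1 R1] cluster_rate[of I2 R2])
    moreover have "2 powr (n * (I3 + \<delta>)) / (M1 * M2) \<le> s n * M0"
    proof -
      have "n * (I3 + \<delta>) \<le> n * (R1 + R2 - I0 + 7 * \<delta>)" using R \<delta> by (intro mult_left_mono) auto
      then have "2 powr (n * (I3 + \<delta>)) \<le> 2 powr (n * (R1 + R2 - I0 + 7 * \<delta>))" by simp
      also have "\<dots> = s n * (m0 * (m1 * m2))"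
        by (simp add: s_def m0_def m1_def m2_def powr_add[symmetric] algebra_simps)
      also have "\<dots> \<le> s n * (M0 * (M1 * M2))"
        unfolding of_nat_mult
        using M0 M1 M2 by (intro mult_left_mono mult_mono) (auto simp: s_def m1_def m2_def)
      finally show ?thesis using M1 M2 by (simp add: divide_le_eq mult.assoc)
    qed
    ultimately have "2 powr (n * (I0 + \<delta>)) + 2 powr (n * (I1 + \<delta>)) / M1 + 2 powr (n * (I2 + \<delta>)) / M2
        + 2 powr (n * (I3 + \<delta>)) / (M1 * M2) \<le> 4 * s n * M0" by linarith
    then have "2 * (2 powr (n * (I0 + \<delta>)) + 2 powr (n * (I1 + \<delta>)) / M1 + 2 powr (n * (I2 + \<delta>)) / M2
        + 2 powr (n * (I3 + \<delta>)) / (M1 * M2)) / M0 \<le> 8 * s n"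
      using M0 by (simp add: divide_le_eq)
    with fail elim have fail: "measure_pmf.prob (map_pmf (map X) ?Q)
      {x. \<not> (\<exists>k<M0. \<exists>a<M1. \<exists>b<M2. \<exists>w\<in>T n. map X w = x \<and> map Y w = y k a \<and> map Z w = z k b)} \<le> \<epsilon>"
      by linarith
    have rate: "real (M0 * L) \<le> 2 powr (n * (R + 6 * \<delta>))"
      if "real L \<le> 2 * 2 powr (n * (R - I0 + 3 * \<delta>))" for R and L :: nat
    proof -
      have "real (M0 * L) \<le> (2 * m0) * (2 * 2 powr (n * (R - I0 + 3 * \<delta>)))"
        unfolding of_nat_mult using M0 that by (intro mult_mono) (auto simp: m0_def)
      also have "\<dots> = 2 powr 2 * 2 powr (n * (R + 5 * \<delta>))"
        by (simp add: m0_def powr_add[symmetric] algebra_simps)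
      also have "\<dots> \<le> 2 powr (n * \<delta>) * 2 powr (n * (R + 5 * \<delta>))"
        using elim(2) by (intro mult_right_mono powr_mono) auto
      also have "\<dots> = 2 powr (n * (R + 6 * \<delta>))"
        by (simp add: powr_add[symmetric] algebra_simps)
      finally show ?thesis .
    qed
    define D where "D x y z \<longleftrightarrow> (\<exists>w\<in>T n. map X w = x \<and> map Y w = y \<and> map Z w = z)" for x y z
    have "\<exists>i j yd zd. coordination_code (R1 + 6 * \<delta>) (R2 + 6 * \<delta>) n i j yd zd \<and>
      (\<forall>x. (\<exists>k<M0. \<exists>a<M1. \<exists>b<M2. D x (y k a) (z k b)) \<longrightarrow> D x (yd (i x)) (zd (j x)))"
    proof (rule code_of_covering)
      show "real (M0 * M1) \<le> 2 powr (n * (R1 + 6 * \<delta>))" "real (M0 * M2) \<le> 2 powr (n * (R2 + 6 * \<delta>))"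
        using M1 M2 by (auto simp only: m1_def m2_def intro!: rate)
      show "length y = n \<and> length z = n" if "D x y z" for x y z
        using that Tn by (auto simp: D_def set_replicate_pmf)
    qed (use M0 M1 M2 in auto)
    then obtain i j yd zd where code: "coordination_code (R1 + 6 * \<delta>) (R2 + 6 * \<delta>) n i j yd zd"
      and D: "\<And>x. (\<exists>k<M0. \<exists>a<M1. \<exists>b<M2. D x (y k a) (z k b)) \<Longrightarrow> D x (yd (i x)) (zd (j x))" by blast
    have tv: "tv_dist (joint_type x y z) (pmf (map_pmf ?XYZ q)) \<le> \<epsilon>" if D_xyz: "D x y z" for x y z
    proof -
      obtain ws where ws: "ws \<in> T n" and xyz: "x = map X ws" "y = map Y ws" "z = map Z ws"
        using D_xyz by (auto simp: D_def)
      have len: "length ws = n" using Tn[OF ws] by (simp add: set_replicate_pmf)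
      have "\<bar>joint_type x y z t - pmf (map_pmf ?XYZ q) t\<bar> \<le> \<eta>" for t
      proof -
        have "measure_pmf.expectation q (\<lambda>w. of_bool (?XYZ w = t)) = pmf (map_pmf ?XYZ q) t"
          unfolding pmf_map prob_eq_expectation by simp
        then have "\<bar>(\<Sum>w\<leftarrow>ws. of_bool (?XYZ w = t)) - n * pmf (map_pmf ?XYZ q) t\<bar> < n * \<eta>"
          using T_dev[OF ws, of "\<lambda>w. of_bool (?XYZ w = t)"] by (simp add: H_def)
        moreover have "(\<Sum>w\<leftarrow>ws. of_bool (?XYZ w = t)) = n * joint_type x y z t"
          using n unfolding xyz joint_type_map len by simp
        ultimately have "\<bar>n * (joint_type x y z t - pmf (map_pmf ?XYZ q) t)\<bar> < n * \<eta>"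
          by (simp only: right_diff_distrib)
        then have "n * \<bar>joint_type x y z t - pmf (map_pmf ?XYZ q) t\<bar> < n * \<eta>"
          by (simp only: abs_mult abs_of_nat)
        then show ?thesis using n by simp
      qed
      then have "(\<Sum>t\<in>UNIV. \<bar>joint_type x y z t - pmf (map_pmf ?XYZ q) t\<bar>) \<le> (\<Sum>t\<in>(UNIV :: ('x \<times> 'y \<times> 'z) set). \<eta>)"
        by (intro sum_mono)
      also have "\<dots> = c * \<eta>" by (simp add: c_def)
      finally show ?thesis using \<eta> \<epsilon> by (simp add: tv_dist_def)
    qed
    have "measure_pmf.prob (replicate_pmf n (map_pmf X q))
        {xs. tv_dist (joint_type xs (yd (i xs)) (zd (j xs))) (pmf (map_pmf ?XYZ q)) > \<epsilon>}
      \<le> measure_pmf.prob (map_pmf (map X) ?Q)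
      {x. \<not> (\<exists>k<M0. \<exists>a<M1. \<exists>b<M2. \<exists>w\<in>T n. map X w = x \<and> map Y w = y k a \<and> map Z w = z k b)}"
      unfolding map_replicate_pmf
    proof (intro measure_pmf.finite_measure_mono subsetI CollectI notI)
      fix x assume *: "x \<in> {xs. tv_dist (joint_type xs (yd (i xs)) (zd (j xs))) (pmf (map_pmf ?XYZ q)) > \<epsilon>}"
      assume "\<exists>k<M0. \<exists>a<M1. \<exists>b<M2. \<exists>w\<in>T n. map X w = x \<and> map Y w = y k a \<and> map Z w = z k b"
      then have "D x (yd (i x)) (zd (j x))" by (intro D) (simp add: D_def)
      with tv * show False by fastforce
    qed auto
    with fail code show ?case by (meson order.trans)
  qed
  then show ?thesis by (simp add: eventually_sequentially)
qed

text \<open>The codes in the hypothesis may depend on \<epsilon>; the diagonal choice turns them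
  into one sequence.\<close>

lemma achievable_if_codes_exist:
  fixes p0 :: "'x::finite pmf" and K :: "'x \<Rightarrow> ('y::finite \<times> 'z::finite) pmf"
  assumes R: "R1 \<ge> 0" "R2 \<ge> 0"
    and codes: "\<And>\<epsilon>. \<epsilon> > 0 \<Longrightarrow> \<exists>N. \<forall>n\<ge>N. \<exists>i j yd zd. coordination_code R1 R2 n i j yd zd \<and>
      measure_pmf.prob (replicate_pmf n p0)
        {xs. tv_dist (joint_type xs (yd (i xs)) (zd (j xs))) (pmf (joint_pmf p0 K)) > \<epsilon>} \<le> \<epsilon>"
  shows "achievable p0 K R1 R2"
proof -
  define err where "err n \<epsilon> = (\<lambda>(i, j, yd, zd). measure_pmf.prob (replicate_pmf n p0)
        {xs. tv_dist (joint_type xs (yd (i xs :: nat)) (zd (j xs :: nat))) (pmf (joint_pmf p0 K)) > \<epsilon>})" for n \<epsilon>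
  define Q where "Q n \<epsilon> c \<longleftrightarrow> (case c of (i, j, yd, zd) \<Rightarrow> coordination_code R1 R2 n i j yd zd) \<and> err n \<epsilon> c \<le> \<epsilon>" for n \<epsilon> c
  have err_mono: "err n \<epsilon>' c \<le> err n \<epsilon> c" if "\<epsilon> \<le> \<epsilon>'" for n \<epsilon> \<epsilon>' c
    unfolding err_def case_prod_unfold using that by (intro measure_pmf.finite_measure_mono) auto
  have "\<exists>c. (\<forall>n. Q n 1 (c n)) \<and> (\<forall>\<epsilon>>0. \<exists>N. \<forall>n\<ge>N. Q n \<epsilon> (c n))"
  proof (rule diagonal_choice)
    show "Q n \<epsilon>' c" if "Q n \<epsilon> c" "\<epsilon> \<le> \<epsilon>'" for n \<epsilon> \<epsilon>' c
      using that err_mono[of \<epsilon> \<epsilon>' n c] unfolding Q_def by linarith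
    show "\<exists>N. \<forall>n\<ge>N. \<exists>c. Q n \<epsilon> c" if "\<epsilon> > 0" for \<epsilon>
      using codes[OF that] unfolding Q_def err_def by simp
    show "\<exists>c. Q n 1 c" for n
    proof -
      \<comment> \<open>Nonnegative rates always allow a constant message, and with tolerance 1 the
        probability condition is trivial.\<close>
      have "1 \<in> message_set R1 n" "1 \<in> message_set R2 n"
        using R by (auto simp: message_set_def intro!: ge_one_powr_ge_zero)
      then have "Q n 1 (\<lambda>_. 1, \<lambda>_. 1, \<lambda>_. replicate n undefined, \<lambda>_. replicate n undefined)"
        by (simp add: Q_def err_def coordination_code_def)
      then show ?thesis by blast
    qed
  qed
  then obtain c where c1: "\<And>n. Q n 1 (c n)" and c: "\<And>\<epsilon>. \<epsilon> > 0 \<Longrightarrow> \<exists>N. \<forall>n\<ge>N. Q n \<epsilon> (c n)" by blast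
  have err_lim: "(\<lambda>n. err n \<epsilon> (c n)) \<longlonglongrightarrow> 0" if \<epsilon>: "\<epsilon> > 0" for \<epsilon>
  proof (rule LIMSEQ_I)
    fix \<eta> :: real assume "\<eta> > 0"
    \<comment> \<open>One parameter bounds both the distance and the probability, so it is taken
      below both targets.\<close>
    then obtain N where N: "\<And>n. n \<ge> N \<Longrightarrow> Q n (min \<epsilon> (\<eta> / 2)) (c n)"
      using c[of "min \<epsilon> (\<eta> / 2)"] \<epsilon> by auto
    have "norm (err n \<epsilon> (c n) - 0) < \<eta>" if "n \<ge> N" for n
    proof -
      have "err n \<epsilon> (c n) \<le> err n (min \<epsilon> (\<eta> / 2)) (c n)" by (rule err_mono) simp
      also have "\<dots> \<le> \<eta> / 2" using N[OF that] by (simp add: Q_def)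
      finally show ?thesis using \<open>\<eta> > 0\<close> by (simp add: err_def case_prod_unfold)
    qed
    then show "\<exists>N. \<forall>n\<ge>N. norm (err n \<epsilon> (c n) - 0) < \<eta>" by blast
  qed
  define i j yd zd where "i n = fst (c n)" and "j n = fst (snd (c n))" and "yd n = fst (snd (snd (c n)))"
    and "zd n = snd (snd (snd (c n)))" for n
  have ijyz: "c n = (i n, j n, yd n, zd n)" for n by (simp add: i_def j_def yd_def zd_def)
  have "coordination_code R1 R2 n (i n) (j n) (yd n) (zd n)" for n
    using c1[of n] by (simp add: Q_def ijyz)
  moreover have "(\<lambda>n. measure_pmf.prob (replicate_pmf n p0)
      {xs. tv_dist (joint_type xs (yd n (i n xs)) (zd n (j n xs))) (pmf (joint_pmf p0 K)) > \<epsilon>}) \<longlonglongrightarrow> 0"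
    if "\<epsilon> > 0" for \<epsilon>
    using err_lim[OF that] by (simp add: err_def ijyz)
  ultimately show ?thesis
    unfolding achievable_def
    by blast
qed

lemma pmf_entropy_const: "pmf_entropy q (\<lambda>_. a) = 0"
  by (simp add: pmf_entropy_def atom_prob_def)

lemma inner_region_achievable:
  fixes p0 :: "'x::finite pmf" and K :: "'x \<Rightarrow> ('y::finite \<times> 'z::finite) pmf" and W :: "'x \<Rightarrow> 'y \<Rightarrow> 'z \<Rightarrow> nat pmf"
  defines "q \<equiv> joint_aux_pmf p0 K W" and "X \<equiv> (\<lambda>(x, y, z, u). x)" and "Y \<equiv> (\<lambda>(x, y, z, u). y)"
    and "Z \<equiv> (\<lambda>(x, y, z, u). z)" and "U \<equiv> (\<lambda>(x, y, z, u). u)"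
  assumes W: "\<And>x y z. set_pmf (W x y z) \<subseteq> {..<m}" and nonneg: "R1 \<ge> 0" "R2 \<ge> 0"
    and R1: "R1 \<ge> mutual_info q X (\<lambda>w. (U w, Y w))"
    and R2: "R2 \<ge> mutual_info q X (\<lambda>w. (U w, Z w))"
    and R12: "R1 + R2 \<ge> mutual_info q X (\<lambda>w. (U w, Y w)) + mutual_info q X (\<lambda>w. (U w, Z w))
      + cond_mutual_info q Y Z (\<lambda>w. (X w, U w))"
    and \<gamma>: "\<gamma> > 0"
  shows "achievable p0 K (R1 + \<gamma>) (R2 + \<gamma>)"
proof -
  have "finite (set_pmf (W x y z))" for x y z by (rule finite_subset[OF W finite_lessThan])
  then have fin: "finite (set_pmf q)"
    unfolding q_def joint_aux_pmf_def by (auto simp: case_prod_unfold)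
  have XYZ: "map_pmf (\<lambda>w. (X w, Y w, Z w)) q = joint_pmf p0 K"
    unfolding q_def joint_aux_pmf_def X_def Y_def Z_def
    by (simp add: map_bind_pmf case_prod_unfold bind_return_pmf')
  have "map_pmf X q = map_pmf fst (map_pmf (\<lambda>w. (X w, Y w, Z w)) q)" by (simp add: pmf.map_comp o_def)
  also have "\<dots> = p0" by (simp add: XYZ map_fst_joint_pmf)
  finally have X: "map_pmf X q = p0" .
  \<comment> \<open>The unit components match \<open>entropy_submodular\<close> with a constant
    third variable, which yields I(X;U) \<ge> 0.\<close>
  have perm: "pmf_entropy q (\<lambda>w. (Y w, X w, U w)) = pmf_entropy q (\<lambda>w. (X w, U w, Y w))"
    "pmf_entropy q (\<lambda>w. (Z w, X w, U w)) = pmf_entropy q (\<lambda>w. (X w, U w, Z w))"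
    "pmf_entropy q (\<lambda>w. (Y w, Z w, X w, U w)) = pmf_entropy q (\<lambda>w. (X w, U w, Y w, Z w))"
    "pmf_entropy q (\<lambda>w. (X w, Y w, U w)) = pmf_entropy q (\<lambda>w. (X w, U w, Y w))"
    "pmf_entropy q (\<lambda>w. (X w, Z w, U w)) = pmf_entropy q (\<lambda>w. (X w, U w, Z w))"
    "pmf_entropy q (\<lambda>w. (Y w, U w)) = pmf_entropy q (\<lambda>w. (U w, Y w))"
    "pmf_entropy q (\<lambda>w. (Z w, U w)) = pmf_entropy q (\<lambda>w. (U w, Z w))"
    "pmf_entropy q (\<lambda>w. (X w, U w, ())) = pmf_entropy q (\<lambda>w. (X w, U w))"
    "pmf_entropy q (\<lambda>w. (X w, ())) = pmf_entropy q X"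
    "pmf_entropy q (\<lambda>w. (U w, ())) = pmf_entropy q U"
    by (intro pmf_entropy_cong; auto)+
  note info = mutual_info_eq_entropy[OF fin] cond_mutual_info_eq_entropy[OF fin] perm
  \<comment> \<open>The covering codes spend six units of slack, hence \<gamma>/6.\<close>
  have "\<exists>N. \<forall>n\<ge>N. \<exists>i j yd zd. coordination_code (R1 + 6 * (\<gamma> / 6)) (R2 + 6 * (\<gamma> / 6)) n i j yd zd \<and>
      measure_pmf.prob (replicate_pmf n (map_pmf X q))
        {xs. tv_dist (joint_type xs (yd (i xs)) (zd (j xs))) (pmf (map_pmf (\<lambda>w. (X w, Y w, Z w)) q)) > \<epsilon>} \<le> \<epsilon>"
    if "\<epsilon> > 0" for \<epsilon>
  proof (rule covering_codes_exist[OF fin refl refl refl refl])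
    show "0 \<le> pmf_entropy q X + pmf_entropy q U - pmf_entropy q (\<lambda>w. (X w, U w))"
      using entropy_submodular[OF fin, of X U "\<lambda>_. ()"] by (simp add: perm pmf_entropy_const)
    show "pmf_entropy q X + pmf_entropy q U - pmf_entropy q (\<lambda>w. (X w, U w))
      \<le> pmf_entropy q X + pmf_entropy q (\<lambda>w. (U w, Y w)) - pmf_entropy q (\<lambda>w. (X w, U w, Y w))"
      using entropy_submodular[OF fin, of X Y U] by (simp add: perm)
    show "pmf_entropy q X + pmf_entropy q U - pmf_entropy q (\<lambda>w. (X w, U w))
      \<le> pmf_entropy q X + pmf_entropy q (\<lambda>w. (U w, Z w)) - pmf_entropy q (\<lambda>w. (X w, U w, Z w))"
      using entropy_submodular[OF fin, of X Z U] by (simp add: perm)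
    show "pmf_entropy q X + pmf_entropy q U - pmf_entropy q (\<lambda>w. (X w, U w)) +
      (pmf_entropy q X + pmf_entropy q (\<lambda>w. (U w, Y w)) + pmf_entropy q (\<lambda>w. (U w, Z w)) -
       pmf_entropy q U - pmf_entropy q (\<lambda>w. (X w, U w, Y w, Z w))) \<le> R1 + R2"
      using R12 by (simp add: info)
  qed (use R1 R2 \<gamma> that in \<open>simp_all add: info\<close>)
  then show ?thesis
    using nonneg \<gamma> unfolding X XYZ by (intro achievable_if_codes_exist) auto
qed

text \<open>Rates are achieved only with slack \<gamma> > 0; letting \<gamma> tend to 0 with the
  kernel fixed stays in the closed capacity region.\<close>

lemma inner_region_subset_capacity_region:
  fixes p0 :: "'x::finite pmf"
  shows "(inner_region p0 :: ('x, 'y::finite, 'z::finite) rate_tuple set) \<subseteq> capacity_region p0"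
proof
  fix v :: "('x, 'y, 'z) rate_tuple" assume "v \<in> inner_region p0"
  then obtain R1 R2 K m W where v: "v = rate_tuple R1 R2 K" and nonneg: "R1 \<ge> 0" "R2 \<ge> 0"
    and ach: "\<And>\<gamma>. \<gamma> > 0 \<Longrightarrow> achievable p0 K (R1 + \<gamma>) (R2 + \<gamma>)"
    unfolding inner_region_def Let_def using inner_region_achievable by blast
  have "((\<lambda>\<gamma>. rate_tuple (R1 + \<gamma>) (R2 + \<gamma>) K) \<longlongrightarrow> rate_tuple (R1 + 0) (R2 + 0) K) (at_right 0)"
    unfolding rate_tuple_def by (intro tendsto_intros)
  moreover have "eventually (\<lambda>\<gamma>. rate_tuple (R1 + \<gamma>) (R2 + \<gamma>) K \<in> capacity_region p0) (at_right 0)"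
    unfolding capacity_region_def
    by (intro eventually_at_right_less[THEN eventually_mono] closure_subset[THEN subsetD])
       (use nonneg ach in force)
  ultimately show "v \<in> capacity_region p0"
    unfolding v by (intro Lim_in_closed_set[of "capacity_region p0"]) (auto simp: capacity_region_def)
qed

theorem theorem7:
  fixes p0 :: "'x::finite pmf"
  shows "(inner_region p0 :: ('x, 'y::finite, 'z::finite) rate_tuple set) \<subseteq> capacity_region p0 \<and>
         (capacity_region p0 :: ('x, 'y, 'z) rate_tuple set) \<subseteq> outer_region p0"
  using inner_region_subset_capacity_region capacity_region_subset_outer_region by blast

end
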